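(* (i) Let $(a,b,c)$ be a Markov triple with $0<a<b$, $0<c<b$, $6\leq b$. Then there exists a unique reduced polynomial solution $(f_1^*,f_2,f_3^* )\in\Gamma_MI$ such that $\mathrm{Ev}(f_1^*,f_2,f_3^* )=(a,b,c)$. Moreover, for that reduced polynomial solution the triple $f=(f_1,f_2,f_3)$ is admissible. (ii) Let $(f_1^*,f_2,f_3^* )\in\Gamma_M I$ be the reduced polynomial presentation of a Markov triple $(a,b,c)$ with $0<a<b$, $0<c<b$, $6\leq b$, and let $d_1=\deg f_1$, $d_3=\deg f_3$. Then $$\bigl(\mu(f_1)^*,\ \mu(f_1)f_2-s_3^{d_1}f_3,\ f_2^*\bigr)$$ is the reduced polynomial presentation of the Markov triple $(a,ab-c,b)$, and $$\bigl(f_2^*,\ f_2\mu(f_3)-s_3^{d_3}f_1,\ \mu(f_3)^*\bigr)$$ is the reduced polynomial presentation of the Markov triple $(b,bc-a,c)$.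
   Context: A Markov triple is a triple $(a,b,c)$ of positive integers with $a^2+b^2+c^2-abc=0$. Let $A=\mathbb Z[s_1,s_2,s_3^{\pm1}]$ with the ring involution $f^*(s_1,s_2,s_3)=f\left(\frac{s_2}{s_3},\frac{s_1}{s_3},\frac1{s_3}\right)$. The $*$-Markov equation for $(a,b,c)\in A^3$ is $aa^*+bb^*+cc^*-abc=\frac{3s_1s_2-s_1^3}{s_3}$. Its initial solution is $I=(s_1,\frac{s_1}{s_3},s_1)$. The evaluation map $\mathrm{Ev}:A^3\to\mathbb Z^3$ evaluates each coordinate at $s_1=3,s_2=3,s_3=1$. The $*$-Markov group $\Gamma_M$ is the group of transformations of $A^3$ generated by: $\lambda_{i,j}:(a,b,c)\mapsto((-1)^ia,(-1)^{i+j}b,(-1)^jc)$, $i,j\in\mathbb Z/2$; $\sigma_1:(a,b,c)\mapsto(b,a,c)$ and $\sigma_2:(a,b,c)\mapsto(a,c,b)$; $\tau_1:(a,b,c)\mapsto(-a^*,c^*,b^*-ac)$ and $\tau_2:(a,b,c)\mapsto(b^*,a^*-bc,-c^* )$; $\mu_{i,j}:(a,b,c)\mapsto(s_3^ia,s_3^{-i-j}b,s_3^jc)$, $i,j\in\mathbb Z$. $\Gamma_MI$ is the orbit of $I$. A solution of the $*$-Markov equation written in the form $(f_1^*,f_2,f_3^* )$ is a reduced polynomial solution if each of $f_1,f_2,f_3$ is a nonconstant polynomial in $s_1,s_2,s_3$ not divisible by $s_3$. "The reduced polynomial presentation" of a Markov triple as in (i) is the unique reduced polynomial solution in $\Gamma_MI$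 whose image under $\mathrm{Ev}$ is that triple. For a polynomial $f(s_1,s_2,s_3)$, its bi-degree vector is $(d,q)$, where $d=\deg f$ is the degree with respect to weights $(1,1,1)$ of $(s_1,s_2,s_3)$ and $q=\mathrm{Deg} f$ is the degree with respect to weights $(1,2,3)$. For $f$ of degree $d=\deg f$ not divisible by $s_3$, put $\mu(f)=s_3^{d}f\left(\frac{s_2}{s_3},\frac{s_1}{s_3},\frac1{s_3}\right)$, a polynomial. A triple $(f_1,f_2,f_3)$ of polynomials in $s_1,s_2,s_3$ is admissible if each $f_j$ is not divisible by $s_3$, each $f_j$ is quasi-homogeneous with respect to weights $(1,2,3)$, and the bi-degree vectors $(d_j,q_j)$ of $f_j$ satisfy $(d_1,q_1)+(d_3,q_3)=(d_2,q_2)$. *)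

theory Defs
  imports
    "HOL-Library.Poly_Mapping"
    "HOL-Library.Product_Plus"
    "HOL-Algebra.Bij"
    "HOL-Algebra.Generated_Groups"
begin

section \<open>The ring of polynomials in two variables and Laurent polynomials in the third\<close>

text \<open>
  The ring A of integer polynomials in s1, s2 and the invertible variable s3 is the monoid
  ring over the additive monoid of exponent vectors: the key (i, j, k) stands for
  the monomial s1^i s2^j s3^k.
\<close>

type_synonym A = "(nat \<times> nat \<times> int) \<Rightarrow>\<^sub>0 int"

definition s1 :: A where "s1 = Poly_Mapping.single (1, 0, 0) 1"
definition s2 :: A where "s2 = Poly_Mapping.single (0, 1, 0) 1"

definition s3_pow :: "int \<Rightarrow> A"  \<comment> \<open>integer powers, as s3 is a unit of A\<close>
  where "s3_pow k = Poly_Mapping.single (0, 0, k) 1"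

abbreviation s3 :: A where "s3 \<equiv> s3_pow 1"
abbreviation s3_inv :: A where "s3_inv \<equiv> s3_pow (-1)"

text \<open>
  Substitution of x, y, z for s1, s2, s3 in f; the last argument is to be the inverse of z.
\<close>

definition subst_A :: "A \<Rightarrow> 'r \<Rightarrow> 'r \<Rightarrow> 'r \<Rightarrow> 'r \<Rightarrow> 'r::comm_ring_1" where
  "subst_A f x y z z_inv =
     (\<Sum>(i, j, k) \<in> Poly_Mapping.keys f.
        of_int (Poly_Mapping.lookup f (i, j, k)) * x ^ i * y ^ j *
        (if 0 \<le> k then z ^ nat k else z_inv ^ nat (- k)))"

definition star :: "A \<Rightarrow> A" where
  "star f = subst_A f (s2 * s3_inv) (s1 * s3_inv) s3_inv s3"

definition ev :: "A \<Rightarrow> int" where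
  "ev f = subst_A f 3 3 1 1"

fun Ev :: "A \<times> A \<times> A \<Rightarrow> int \<times> int \<times> int" where
  "Ev (a, b, c) = (ev a, ev b, ev c)"


section \<open>Markov triples and the star-Markov equation\<close>

fun markov_triple :: "int \<times> int \<times> int \<Rightarrow> bool" where
  "markov_triple (a, b, c) \<longleftrightarrow>
     0 < a \<and> 0 < b \<and> 0 < c \<and> a^2 + b^2 + c^2 - a * b * c = 0"

fun star_markov_solution :: "A \<times> A \<times> A \<Rightarrow> bool" where
  "star_markov_solution (a, b, c) \<longleftrightarrow>
     a * star a + b * star b + c * star c - a * b * c = (3 * s1 * s2 - s1 ^ 3) * s3_inv"

definition initial_solution :: "A \<times> A \<times> A" where
  "initial_solution = (s1, s1 * s3_inv, s1)"


section \<open>The star-Markov group\<close>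

definition lam :: "nat \<Rightarrow> nat \<Rightarrow> A \<times> A \<times> A \<Rightarrow> A \<times> A \<times> A" where
  \<comment> \<open>depends only on the parities of i and j\<close>
  "lam i j = (\<lambda>(a, b, c). ((-1) ^ i * a, (-1) ^ (i + j) * b, (-1) ^ j * c))"

definition sigma1 :: "A \<times> A \<times> A \<Rightarrow> A \<times> A \<times> A" where
  "sigma1 = (\<lambda>(a, b, c). (b, a, c))"

definition sigma2 :: "A \<times> A \<times> A \<Rightarrow> A \<times> A \<times> A" where
  "sigma2 = (\<lambda>(a, b, c). (a, c, b))"

definition tau1 :: "A \<times> A \<times> A \<Rightarrow> A \<times> A \<times> A" where
  "tau1 = (\<lambda>(a, b, c). (- star a, star c, star b - a * c))"

definition tau2 :: "A \<times> A \<times> A \<Rightarrow> A \<times> A \<times> A" where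
  "tau2 = (\<lambda>(a, b, c). (star b, star a - b * c, - star c))"

definition mu_act :: "int \<Rightarrow> int \<Rightarrow> A \<times> A \<times> A \<Rightarrow> A \<times> A \<times> A" where
  "mu_act i j = (\<lambda>(a, b, c). (s3_pow i * a, s3_pow (- i - j) * b, s3_pow j * c))"

definition Gamma_M :: "(A \<times> A \<times> A \<Rightarrow> A \<times> A \<times> A) set" where
  "Gamma_M = generate (BijGroup UNIV)
     ({lam i j | i j. True} \<union> {sigma1, sigma2, tau1, tau2} \<union> {mu_act i j | i j. True})"

definition Gamma_M_orbit :: "(A \<times> A \<times> A) set" where
  "Gamma_M_orbit = {g initial_solution | g. g \<in> Gamma_M}"


section \<open>Polynomials in s1, s2, s3\<close>

definition is_polynomial :: "A \<Rightarrow> bool" where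
  "is_polynomial f \<longleftrightarrow> (\<forall>(i, j, k) \<in> Poly_Mapping.keys f. 0 \<le> k)"

definition nonconstant :: "A \<Rightarrow> bool" where
  "nonconstant f \<longleftrightarrow> (\<nexists>m::int. f = of_int m)"

text \<open>
  Divisibility by s3 is meant in the ring of polynomials, as s3 is invertible in A.
\<close>

definition s3_divides :: "A \<Rightarrow> bool" where
  "s3_divides f \<longleftrightarrow> (\<exists>g. is_polynomial g \<and> f = s3 * g)"

text \<open>
  Degrees are only meaningful for polynomials, where all exponents of s3 are nonnegative;
  the zero polynomial gets degree 0.
\<close>

definition monom_weight :: "nat \<times> nat \<times> nat \<Rightarrow> nat \<times> nat \<times> int \<Rightarrow> nat" where
  "monom_weight = (\<lambda>(u, v, w) (i, j, k). u * i + v * j + w * nat k)"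

definition weighted_degree :: "nat \<times> nat \<times> nat \<Rightarrow> A \<Rightarrow> nat" where
  "weighted_degree w f = Max (insert 0 (monom_weight w ` Poly_Mapping.keys f))"

definition deg :: "A \<Rightarrow> nat" where "deg = weighted_degree (1, 1, 1)"
definition Deg :: "A \<Rightarrow> nat" where "Deg = weighted_degree (1, 2, 3)"

definition bidegree :: "A \<Rightarrow> nat \<times> nat" where
  "bidegree f = (deg f, Deg f)"

definition quasi_homogeneous :: "A \<Rightarrow> bool" where
  "quasi_homogeneous f \<longleftrightarrow>
     (\<exists>q. \<forall>m \<in> Poly_Mapping.keys f. monom_weight (1, 2, 3) m = q)"

definition mu :: "A \<Rightarrow> A" where
  "mu f = s3 ^ deg f * subst_A f (s2 * s3_inv) (s1 * s3_inv) s3_inv s3"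

fun admissible :: "A \<times> A \<times> A \<Rightarrow> bool" where
  "admissible (f1, f2, f3) \<longleftrightarrow>
     (\<forall>f \<in> {f1, f2, f3}. is_polynomial f \<and> \<not> s3_divides f \<and> quasi_homogeneous f) \<and>
     bidegree f1 + bidegree f3 = bidegree f2"


section \<open>Reduced polynomial solutions\<close>

definition reduced_polynomial_solution :: "A \<times> A \<times> A \<Rightarrow> bool" where
  "reduced_polynomial_solution X \<longleftrightarrow>
     star_markov_solution X \<and>
     (\<exists>f1 f2 f3. X = (star f1, f2, star f3) \<and>
        (\<forall>f \<in> {f1, f2, f3}. is_polynomial f \<and> nonconstant f \<and> \<not> s3_divides f))"

text \<open>
  X is the reduced polynomial presentation of the triple (a, b, c); this is only
  meaningful for Markov triples with a large middle entry, for which such an X exists uniquely.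
\<close>

fun reduced_polynomial_presentation :: "A \<times> A \<times> A \<Rightarrow> int \<times> int \<times> int \<Rightarrow> bool" where
  "reduced_polynomial_presentation X (a, b, c) \<longleftrightarrow>
     markov_triple (a, b, c) \<and> 0 < a \<and> a < b \<and> 0 < c \<and> c < b \<and> 6 \<le> b \<and>
     X \<in> Gamma_M_orbit \<and> reduced_polynomial_solution X \<and> Ev X = (a, b, c) \<and>
     (\<forall>Y \<in> Gamma_M_orbit.
        reduced_polynomial_solution Y \<and> Ev Y = (a, b, c) \<longrightarrow> Y = X)"

end

theory Submission
  imports Defs "HOL-Library.Product_Lexorder"
begin

text \<open>
  The generators tau1 and tau2 are, up to signs and permutations, the Vieta move
  (a, b, c) \<mapsto> (a*, ac - b*, c*), an involution that evaluates to the classical move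
  (a, b, c) \<mapsto> (a, ac - b, c) on Markov triples. Everything rests on the fact that Markov triples
  form a tree rooted at (3, 3, 3) under these moves, and that an element of the orbit of the
  initial solution is determined, up to the powers of s3 allowed by mu_act, by its Markov triple.

  Uniqueness. Every element of the orbit is, up to signs, obtained from the root
  (s3^i s1, s3^(-i-j-1) s1, s3^j s1) by permutations and by Vieta moves that increase the replaced
  entry after evaluation (orbit_ascent_up_to_sign). The point is that the set of such elements is
  closed under all Vieta moves: after an ascent in one position, the move in that position undoes
  it, and the moves in the two other positions are again ascents (ascent_vieta_all). Since a Vieta
  move can be undone, an induction along the ascent shows that two orbit elements with the same
  positive evaluation differ by some mu_act i j (ascent_fibre). A nonzero polynomial that is not
  divisible by s3 loses one of these properties when multiplied by a nontrivial power of s3,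
  so a fibre contains at most one reduced solution (reduced_polynomial_solution_unique).

  Existence. One Vieta move, followed by the mu_act that clears the denominators of f1*, turns
  (f1*, f2, f3*) into the triple of part (ii). That this triple is again reduced and admissible
  is a computation with degrees (admissible_mutation): mu preserves deg, sends Deg f to
  3 deg f - Deg f, and exchanges the terms of f of top degree with the terms of mu f that are
  free of s3. In mu f1 * f2 - s3^(deg f1) f3 the first product dominates in degree and survives
  modulo s3, because deg f1 > 0. The process starts at (s1*, s1^2 - s2, s1*) over (3, 6, 3), and
  descent in the tree of Markov triples reaches every triple with a strictly largest middle entry
  at least 6 (admissible_presentation_exists). The second triple of part (ii) is the mirror
  image of the first.
\<close>

section \<open>Substitution homomorphisms and the involution\<close>

text \<open>
  With w an inverse of z, this is the integer power z^k in a ring that need not have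
  a division operation.
\<close>

definition unit_power :: "'r::comm_ring_1 \<Rightarrow> 'r \<Rightarrow> int \<Rightarrow> 'r" where
  "unit_power z w k = (if 0 \<le> k then z ^ nat k else w ^ nat (- k))"

text \<open>
  Writing an integer as a difference of naturals removes the case distinction on its sign;
  the law of exponents then reduces to the one for natural exponents.
\<close>

lemma unit_power_diff:
  assumes "z * w = 1"
  shows "unit_power z w (int a - int b) = z ^ a * w ^ b"
proof (cases "b \<le> a")
  case True
  then obtain d where "a = b + d" by (auto simp: le_iff_add)
  moreover have "z ^ b * w ^ b = 1"
    using assms by (simp flip: power_mult_distrib)
  ultimately show ?thesis
    by (simp add: unit_power_def power_add ac_simps) (metis mult.assoc mult.left_commute mult.right_neutral)
next
  case False
  then obtain d where d: "b = a + d" "d > 0" by (metis less_imp_add_positive not_le)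
  moreover have "z ^ a * w ^ a = 1"
    using assms by (simp flip: power_mult_distrib)
  ultimately show ?thesis
    by (simp add: unit_power_def power_add mult.assoc [symmetric])
qed

lemma unit_power_add:
  assumes "z * w = 1"
  shows "unit_power z w (k + l) = unit_power z w k * unit_power z w l"
proof -
  obtain a b c d where k: "k = int a - int b" and l: "l = int c - int d"
    by (metis int_diff_cases)
  have "k + l = int (a + c) - int (b + d)" by (simp add: k l)
  then show ?thesis
    unfolding k l using unit_power_diff [OF assms]
    by (metis (no_types, lifting) mult.assoc mult.left_commute power_add)
qed

definition monomial_value :: "'r::comm_ring_1 \<Rightarrow> 'r \<Rightarrow> 'r \<Rightarrow> 'r \<Rightarrow> nat \<times> nat \<times> int \<Rightarrow> 'r" where
  "monomial_value x y z w = (\<lambda>(i, j, k). x ^ i * y ^ j * unit_power z w k)"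

lemma monomial_value_add:
  assumes "z * w = 1"
  shows "monomial_value x y z w (m + n) = monomial_value x y z w m * monomial_value x y z w n"
  by (cases m; cases n)
    (simp add: monomial_value_def power_add unit_power_add [OF assms] ac_simps)

text \<open>
  A summation range that does not depend on the polynomial, so that the sums for two
  polynomials can be combined.
\<close>

lemma subst_A_superset:
  assumes "finite K" "Poly_Mapping.keys f \<subseteq> K"
  shows "subst_A f x y z w =
    (\<Sum>m\<in>K. of_int (Poly_Mapping.lookup f m) * monomial_value x y z w m)"
proof -
  have "subst_A f x y z w =
    (\<Sum>m\<in>Poly_Mapping.keys f. of_int (Poly_Mapping.lookup f m) * monomial_value x y z w m)"
    unfolding subst_A_def monomial_value_def unit_power_def
    by (rule sum.cong) (auto simp: mult.assoc)
  also have "\<dots> = (\<Sum>m\<in>K. of_int (Poly_Mapping.lookup f m) * monomial_value x y z w m)"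
    using assms by (intro sum.mono_neutral_left) (auto simp: in_keys_iff)
  finally show ?thesis .
qed

lemma subst_A_single:
  "subst_A (Poly_Mapping.single m c) x y z w = of_int c * monomial_value x y z w m"
  by (subst subst_A_superset [of "{m}"]) auto

lemma subst_A_0 [simp]: "subst_A 0 x y z w = 0"
  by (simp add: subst_A_def)

lemma subst_A_diff: "subst_A (f - g) x y z w = subst_A f x y z w - subst_A g x y z w"
proof -
  let ?K = "Poly_Mapping.keys f \<union> Poly_Mapping.keys g"
  have K: "finite ?K" "Poly_Mapping.keys (f - g) \<subseteq> ?K"
    by (auto simp: keys_diff)
  show ?thesis
    by (simp add: subst_A_superset [OF K] subst_A_superset [of ?K f] subst_A_superset [of ?K g]
        lookup_minus left_diff_distrib sum_subtractf)
qed

lemma subst_A_minus: "subst_A (- f) x y z w = - subst_A f x y z w"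
  using subst_A_diff [of 0 f] by simp

lemma subst_A_add: "subst_A (f + g) x y z w = subst_A f x y z w + subst_A g x y z w"
  using subst_A_diff [of f "- g"] by (simp add: subst_A_minus)

text \<open>
  Integer combinations of monomials exhaust A, so additive statements need only be checked on
  monomials.
\<close>

lemma A_induct [case_names zero monomial diff]:
  fixes f :: A
  assumes "P 0" "\<And>m. P (Poly_Mapping.single m 1)" "\<And>f g. P f \<Longrightarrow> P g \<Longrightarrow> P (f - g)"
  shows "P f"
  by (rule frag_induction [of f UNIV P]) (use assms in auto)

lemma subst_A_mult:
  assumes "z * w = 1"
  shows "subst_A (f * g) x y z w = subst_A f x y z w * subst_A g x y z w"
proof (induction f rule: A_induct)
  case (monomial m)
  show ?case
    by (induction g rule: A_induct)
      (simp_all add: mult_single subst_A_single monomial_value_add [OF assms]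
        right_diff_distrib subst_A_diff)
qed (simp_all add: left_diff_distrib subst_A_diff)

lemma single_mult_power:
  fixes m :: "nat \<times> nat \<times> int"
  shows "Poly_Mapping.single (i, j, k) (1::int) ^ n =
    Poly_Mapping.single (n * i, n * j, int n * k) 1"
  by (induction n) (auto simp: mult_single algebra_simps zero_prod_def simp flip: single_one)

lemma s3_pow_0 [simp]: "s3_pow 0 = 1"
  by (simp add: s3_pow_def flip: zero_prod_def)

lemma s3_pow_mult: "s3_pow k * s3_pow l = s3_pow (k + l)"
  by (simp add: s3_pow_def mult_single)

lemma s3_pow_mult_left: "s3_pow k * (s3_pow l * f) = s3_pow (k + l) * f"
  by (simp add: s3_pow_mult flip: mult.assoc)

lemma s3_power: "s3 ^ n = s3_pow (int n)"
  by (simp add: s3_pow_def single_mult_power)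

lemma s3_inverse: "s3_inv * s3 = 1"
  by (simp add: s3_pow_mult)

lemma star_diff [simp]: "star (f - g) = star f - star g"
  and star_minus [simp]: "star (- f) = - star f"
  and star_mult [simp]: "star (f * g) = star f * star g"
  and star_0 [simp]: "star 0 = 0"
  unfolding star_def
  by (simp_all add: subst_A_diff subst_A_minus subst_A_mult [OF s3_inverse])

text \<open>
  On exponent vectors the involution acts by the linear map
  (i, j, k) \<mapsto> (j, i, -i-j-k), which is its own inverse.
\<close>

lemma star_single:
  "star (Poly_Mapping.single (i, j, k) c) =
    Poly_Mapping.single (j, i, - int i - int j - k) c"
proof -
  have *: "unit_power s3_inv s3 k = s3_pow (- k)"
    by (auto simp: unit_power_def s3_pow_def single_mult_power)
  have "of_int c * (Poly_Mapping.single m 1 :: A) = Poly_Mapping.single m c" for m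
    by (simp add: mult_single flip: single_of_int)
  then show ?thesis
    unfolding star_def subst_A_single monomial_value_def prod.case *
    by (simp add: s1_def s2_def s3_pow_def mult_single single_mult_power mult.commute
        diff_diff_eq add.commute minus_diff_commute)
qed

lemma star_star [simp]: "star (star f) = f"
proof (induction f rule: A_induct)
  case (monomial m)
  then show ?case by (cases m) (simp add: star_single)
qed simp_all

lemma star_s1: "star s1 = s2 * s3_inv"
  and star_s3_pow: "star (s3_pow k) = s3_pow (- k)"
  by (simp_all add: s1_def s2_def s3_pow_def star_single mult_single)

lemma star_one_power [simp]: "star 1 = 1" "star ((- 1) ^ n) = (- 1) ^ n"
proof -
  show 1: "star 1 = 1" using star_s3_pow [of 0] by simp
  show "star ((- 1) ^ n) = (- 1) ^ n"
    by (induction n) (simp_all add: 1)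
qed

lemma lookup_star:
  "Poly_Mapping.lookup (star f) (i, j, k) =
    Poly_Mapping.lookup f (j, i, - int i - int j - k)"
proof (induction f rule: A_induct)
  case (monomial m)
  then show ?case
    by (cases m) (auto simp: star_single lookup_single when_def)
qed (simp_all add: lookup_minus)

lemma lookup_s3_pow_mult:
  "Poly_Mapping.lookup (s3_pow n * f) (i, j, k) = Poly_Mapping.lookup f (i, j, k - n)"
proof (induction f rule: A_induct)
  case (monomial m)
  then show ?case
    by (cases m) (auto simp: s3_pow_def mult_single lookup_single when_def)
qed (simp_all add: right_diff_distrib lookup_minus)

lemma ev_diff [simp]: "ev (f - g) = ev f - ev g"
  and ev_add [simp]: "ev (f + g) = ev f + ev g"
  and ev_minus [simp]: "ev (- f) = - ev f"
  and ev_mult [simp]: "ev (f * g) = ev f * ev g"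
  and ev_0 [simp]: "ev 0 = 0"
  unfolding ev_def
  by (simp_all add: subst_A_diff subst_A_add subst_A_minus subst_A_mult)

lemma ev_s1 [simp]: "ev s1 = 3"
  and ev_s2 [simp]: "ev s2 = 3"
  and ev_s3_pow [simp]: "ev (s3_pow k) = 1"
  by (simp_all add: ev_def s1_def s2_def s3_pow_def subst_A_single monomial_value_def
      unit_power_def)

lemma ev_1 [simp]: "ev 1 = 1"
  using ev_s3_pow [of 0] by simp

lemma ev_power [simp]: "ev (f ^ n) = ev f ^ n"
  by (induction n) simp_all

lemma ev_numeral [simp]: "ev (numeral n) = numeral n"
proof -
  have "ev (of_nat m) = int m" for m
    by (induction m) simp_all
  from this [of "numeral n"] show ?thesis by simp
qed

lemma ev_star [simp]: "ev (star f) = ev f"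
proof (induction f rule: A_induct)
  case (monomial m)
  then show ?case
    by (cases m) (simp add: star_single ev_def subst_A_single monomial_value_def unit_power_def
        power_add mult.commute)
qed simp_all

section \<open>Orbits of the star-Markov group\<close>

text \<open>
  The classical Vieta move on Markov triples, twisted by the involution. The generators tau1 and
  tau2 differ from it by signs and permutations only; unlike them it is its own inverse.
\<close>

definition vieta :: "A \<times> A \<times> A \<Rightarrow> A \<times> A \<times> A" where
  "vieta = (\<lambda>(a, b, c). (star a, a * c - star b, star c))"

lemma vieta_vieta [simp]: "vieta (vieta X) = X"
  by (cases X) (simp add: vieta_def)

lemma sigma_sigma [simp]: "sigma1 (sigma1 X) = X" "sigma2 (sigma2 X) = X"
  by (cases X; simp add: sigma1_def sigma2_def)+

lemma lam_lam [simp]: "lam i j (lam i j X) = X"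
  by (cases X) (simp add: lam_def flip: mult.assoc power_add mult_2)

lemma mu_act_inverse [simp]: "mu_act i j (mu_act (- i) (- j) X) = X"
  "mu_act (- i) (- j) (mu_act i j X) = X"
  by (cases X; simp add: mu_act_def s3_pow_mult_left)+

lemma tau1_factor: "tau1 X = lam 1 1 (sigma2 (vieta X))"
  and tau2_factor: "tau2 X = lam 0 1 (vieta (sigma1 X))"
  by (cases X; simp add: tau1_def tau2_def lam_def sigma1_def sigma2_def vieta_def)+

lemma BijGroup_UNIV_mult:
  assumes "g \<in> carrier (BijGroup UNIV)" "h \<in> carrier (BijGroup UNIV)"
  shows "(g \<otimes>\<^bsub>BijGroup UNIV\<^esub> h) x = g (h x)"
  using assms by (simp add: BijGroup_def compose_def)

lemma BijGroup_UNIV_memI: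
  assumes "\<And>x. g (h x) = x" "\<And>x. h (g x) = x"
  shows "g \<in> carrier (BijGroup UNIV)"
proof -
  have "bij g" using assms by (metis bijI')
  then show ?thesis by (simp add: BijGroup_def Bij_def)
qed

lemma BijGroup_UNIV_inv:
  assumes "\<And>x. g (h x) = x" "\<And>x. h (g x) = x"
  shows "inv\<^bsub>BijGroup UNIV\<^esub> g = h"
proof (rule group.inv_equality [OF group_BijGroup])
  show gh: "g \<in> carrier (BijGroup UNIV)" "h \<in> carrier (BijGroup UNIV)"
    using assms by (blast intro: BijGroup_UNIV_memI)+
  show "h \<otimes>\<^bsub>BijGroup UNIV\<^esub> g = \<one>\<^bsub>BijGroup UNIV\<^esub>"
    by (rule ext) (simp add: BijGroup_UNIV_mult gh assms, simp add: BijGroup_def)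
qed

abbreviation generators :: "(A \<times> A \<times> A \<Rightarrow> A \<times> A \<times> A) set" where
  "generators \<equiv> {lam i j | i j. True} \<union> {sigma1, sigma2, tau1, tau2} \<union> {mu_act i j | i j. True}"

text \<open>
  The inverses of the generators are composed from lam, sigma1, sigma2, vieta and mu_act. This
  is what makes closure under these five sufficient for an induction over the orbit.
\<close>

lemma generator_inverse:
  assumes "g \<in> generators"
  shows "\<exists>h. (\<forall>X. g (h X) = X) \<and> (\<forall>X. h (g X) = X) \<and>
    (h = g \<or> h = vieta \<circ> sigma2 \<circ> lam 1 1 \<or> h = sigma1 \<circ> vieta \<circ> lam 0 1 \<or>
      (\<exists>i j. h = mu_act i j))"
proof -
  consider "\<exists>i j. g = lam i j" | "g = sigma1" | "g = sigma2" | "g = tau1" | "g = tau2"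
    | "\<exists>i j. g = mu_act i j"
    using assms by blast
  then show ?thesis
  proof cases
    case 1
    then obtain i j where "g = lam i j" by blast
    then show ?thesis by (intro exI [of _ g]) simp
  next
    case 2
    then show ?thesis by (intro exI [of _ g]) simp
  next
    case 3
    then show ?thesis by (intro exI [of _ g]) simp
  next
    case 4
    then show ?thesis
      by (intro exI [of _ "vieta \<circ> sigma2 \<circ> lam 1 1"]) (simp add: tau1_factor del: One_nat_def)
  next
    case 5
    then show ?thesis
      by (intro exI [of _ "sigma1 \<circ> vieta \<circ> lam 0 1"]) (simp add: tau2_factor del: One_nat_def)
  next
    case 6
    then obtain i j where "g = mu_act i j" by blast
    then show ?thesis by (intro exI [of _ "mu_act (- i) (- j)"]) auto
  qed
qed

lemma generators_carrier: "generators \<subseteq> carrier (BijGroup UNIV)"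
proof
  fix g assume "g \<in> generators"
  then obtain h where "\<And>X. g (h X) = X" "\<And>X. h (g X) = X"
    using generator_inverse by blast
  then show "g \<in> carrier (BijGroup UNIV)"
    by (rule BijGroup_UNIV_memI)
qed

lemma Gamma_M_carrier: "g \<in> Gamma_M \<Longrightarrow> g \<in> carrier (BijGroup UNIV)"
  unfolding Gamma_M_def
  by (rule group.generate_in_carrier [OF group_BijGroup generators_carrier])

text \<open>
  An induction principle without inverses: all the moves listed are invertible within the
  list, so a property that they propagate holds on the whole orbit.
\<close>

lemma Gamma_M_orbit_induct [consumes 1, case_names initial lam sigma1 sigma2 vieta mu_act]:
  assumes orbit: "X \<in> Gamma_M_orbit"
    and initial: "P initial_solution"
    and lam: "\<And>i j X. P X \<Longrightarrow> P (lam i j X)"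
    and sigma1: "\<And>X. P X \<Longrightarrow> P (sigma1 X)"
    and sigma2: "\<And>X. P X \<Longrightarrow> P (sigma2 X)"
    and vieta: "\<And>X. P X \<Longrightarrow> P (vieta X)"
    and mu_act: "\<And>i j X. P X \<Longrightarrow> P (mu_act i j X)"
  shows "P X"
proof -
  have gen: "P (g X)" if "g \<in> generators" "P X" for g X
  proof -
    have "P (tau1 X)" "P (tau2 X)"
      unfolding tau1_factor tau2_factor by (intro lam sigma1 sigma2 vieta \<open>P X\<close>)+
    with that lam sigma1 sigma2 mu_act show ?thesis by blast
  qed
  have "\<forall>X. P X \<longrightarrow> P (g X)" if "g \<in> Gamma_M" for g
    using that unfolding Gamma_M_def
  proof (induction g rule: generate.induct)
    case one
    then show ?case by (simp add: BijGroup_def)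
  next
    case (incl g)
    then show ?case using gen by simp
  next
    case (inv g)
    obtain h where h: "\<And>X. g (h X) = X" "\<And>X. h (g X) = X"
      "h = g \<or> h = vieta \<circ> sigma2 \<circ> lam 1 1 \<or> h = sigma1 \<circ> vieta \<circ> lam 0 1 \<or> (\<exists>i j. h = mu_act i j)"
      using generator_inverse [OF inv] by blast
    have "P (h X)" if "P X" for X
    proof -
      have "P ((vieta \<circ> sigma2 \<circ> lam 1 1) X)" "P ((sigma1 \<circ> vieta \<circ> lam 0 1) X)"
        unfolding comp_def by (intro lam sigma1 sigma2 vieta \<open>P X\<close>)+
      with h(3) gen [OF inv that] mu_act [OF that] show ?thesis by metis
    qed
    then show ?case
      using BijGroup_UNIV_inv [of g h] h by simp
  next
    case (eng g h)
    have "g \<in> Gamma_M" "h \<in> Gamma_M"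
      using eng by (simp_all add: Gamma_M_def)
    then show ?case
      using eng.IH by (simp only: BijGroup_UNIV_mult Gamma_M_carrier) blast
  qed
  then show ?thesis
    using orbit initial unfolding Gamma_M_orbit_def by blast
qed

lemma Gamma_M_orbit_generator:
  assumes "g \<in> generators" "X \<in> Gamma_M_orbit"
  shows "g X \<in> Gamma_M_orbit"
proof -
  obtain h where h: "h \<in> Gamma_M" "X = h initial_solution"
    using assms(2) by (auto simp: Gamma_M_orbit_def)
  have "g \<in> Gamma_M"
    unfolding Gamma_M_def using assms(1) by (rule generate.incl)
  moreover from this h have "g \<otimes>\<^bsub>BijGroup UNIV\<^esub> h \<in> Gamma_M"
    unfolding Gamma_M_def by (blast intro: generate.eng)
  ultimately show ?thesis
    unfolding Gamma_M_orbit_def using h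
    by (auto simp: BijGroup_UNIV_mult Gamma_M_carrier
        intro!: exI [of _ "g \<otimes>\<^bsub>BijGroup UNIV\<^esub> h"])
qed

lemma initial_solution_in_orbit: "initial_solution \<in> Gamma_M_orbit"
proof -
  have "\<one>\<^bsub>BijGroup UNIV\<^esub> \<in> Gamma_M"
    unfolding Gamma_M_def by (rule generate.one)
  then show ?thesis
    unfolding Gamma_M_orbit_def
    by (intro CollectI exI [of _ "\<one>\<^bsub>BijGroup UNIV\<^esub>"]) (simp add: BijGroup_def)
qed

lemma Gamma_M_orbit_closed:
  assumes "X \<in> Gamma_M_orbit"
  shows "sigma1 X \<in> Gamma_M_orbit" "sigma2 X \<in> Gamma_M_orbit" "lam i j X \<in> Gamma_M_orbit"
    "mu_act k l X \<in> Gamma_M_orbit" "vieta X \<in> Gamma_M_orbit"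
proof -
  have closed: "g X \<in> Gamma_M_orbit" if "g \<in> generators" "X \<in> Gamma_M_orbit" for g X
    using that by (rule Gamma_M_orbit_generator)
  have "\<And>X. X \<in> Gamma_M_orbit \<Longrightarrow> sigma2 X \<in> Gamma_M_orbit"
    "\<And>X. X \<in> Gamma_M_orbit \<Longrightarrow> tau1 X \<in> Gamma_M_orbit"
    "\<And>i j X. X \<in> Gamma_M_orbit \<Longrightarrow> lam i j X \<in> Gamma_M_orbit"
    by (rule closed; blast)+
  note * = this
  show "sigma1 X \<in> Gamma_M_orbit" "mu_act k l X \<in> Gamma_M_orbit"
    by (rule closed [OF _ assms]; blast)+
  show "sigma2 X \<in> Gamma_M_orbit" "lam i j X \<in> Gamma_M_orbit"
    using assms by (rule *)+
  have "vieta X = sigma2 (lam 1 1 (tau1 X))"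
    by (simp add: tau1_factor del: One_nat_def)
  then show "vieta X \<in> Gamma_M_orbit"
    using * assms by metis
qed

text \<open>
  The left-hand side of the star-Markov equation is invariant under each move. For vieta, with
  b' = ac - b*, one has b'* - a*c* = -b, so that b' b'* - a* b' c* = -b' b = b b* - abc.
\<close>

lemma star_markov_solution_orbit:
  "X \<in> Gamma_M_orbit \<Longrightarrow> star_markov_solution X"
proof (induction X rule: Gamma_M_orbit_induct)
  case initial
  show ?case
    by (simp add: initial_solution_def star_s1 star_s3_pow s3_pow_mult power3_eq_cube algebra_simps)
next
  case (lam i j X)
  with lam show ?case
    by (cases X; cases "even i"; cases "even j") (simp_all add: lam_def)
next
  case (sigma1 X)
  then show ?case by (cases X) (simp add: sigma1_def algebra_simps)
next
  case (sigma2 X)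
  then show ?case by (cases X) (simp add: sigma2_def algebra_simps)
next
  case (vieta X)
  then show ?case by (cases X) (simp add: vieta_def algebra_simps)
next
  case (mu_act i j X)
  obtain a b c where X: "X = (a, b, c)" by (cases X)
  have norm: "s3_pow k * f * star (s3_pow k * f) = f * star f" for k f
  proof -
    have "s3_pow k * f * star (s3_pow k * f) = (s3_pow k * s3_pow (- k)) * (f * star f)"
      by (simp add: star_s3_pow ac_simps)
    then show ?thesis by (simp add: s3_pow_mult)
  qed
  have "s3_pow i * a * (s3_pow (- i - j) * b) * (s3_pow j * c) =
      (s3_pow i * s3_pow (- i - j) * s3_pow j) * (a * b * c)"
    by (simp add: ac_simps)
  also have "\<dots> = a * b * c" by (simp add: s3_pow_mult)
  finally show ?case using mu_act by (simp only: X mu_act_def prod.case star_markov_solution.simps norm)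
qed

section \<open>Ascending Vieta moves and the fibres of evaluation\<close>

text \<open>
  The part of the orbit over positive triples, generated without ever going down: the condition
  2 ev b < ev a * ev c says that the new entry ev a * ev c - ev b is larger than ev b. The root
  is the class of the initial solution modulo mu_act; permutations preserve this class.
\<close>

inductive ascent :: "A \<times> A \<times> A \<Rightarrow> bool" where
  root: "ascent (s3_pow i * s1, s3_pow (- i - j - 1) * s1, s3_pow j * s1)"
| swap1: "ascent X \<Longrightarrow> ascent (sigma1 X)"
| swap2: "ascent X \<Longrightarrow> ascent (sigma2 X)"
| up: "ascent (a, b, c) \<Longrightarrow> 2 * ev b < ev a * ev c \<Longrightarrow> ascent (vieta (a, b, c))"

lemma ascent_ev:
  assumes "ascent X"
  shows "case Ev X of (a, b, c) \<Rightarrow> 3 \<le> a \<and> 3 \<le> b \<and> 3 \<le> c \<and> a\<^sup>2 + b\<^sup>2 + c\<^sup>2 = a * b * c"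
  using assms
proof induction
  case (swap1 X)
  then show ?case by (cases X rule: prod_cases3) (simp add: sigma1_def algebra_simps)
next
  case (swap2 X)
  then show ?case by (cases X rule: prod_cases3) (simp add: sigma2_def algebra_simps)
next
  case (up a b c)
  have "x\<^sup>2 + (x * z - y)\<^sup>2 + z\<^sup>2 = x * (x * z - y) * z"
    if "x\<^sup>2 + y\<^sup>2 + z\<^sup>2 = x * y * z" for x y z :: int
    using that by (simp add: power2_eq_square algebra_simps)
  with up show ?case by (simp add: vieta_def)
qed simp

text \<open>
  After an ascent the new entry b' = ac - b exceeds both a and c, since
  b'^2 > b b' = a^2 + c^2. Replacing a or c next therefore is an ascent again.
\<close>

lemma vieta_ascent_step:
  fixes a b c :: int
  assumes "3 \<le> a" "3 \<le> b" "3 \<le> c" "a\<^sup>2 + b\<^sup>2 + c\<^sup>2 = a * b * c" "2 * b < a * c"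
  shows "2 * a < (a * c - b) * c" "2 * c < a * (a * c - b)"
proof -
  have prod: "b * (a * c - b) = a\<^sup>2 + c\<^sup>2"
    using assms(4) by (simp add: power2_eq_square algebra_simps)
  have "b * (a * c - b) < (a * c - b) * (a * c - b)"
    by (rule mult_strict_right_mono) (use assms in auto)
  then have sq: "a\<^sup>2 + c\<^sup>2 < (a * c - b)\<^sup>2"
    using prod by (simp add: power2_eq_square)
  have "a\<^sup>2 < (a * c - b)\<^sup>2" "c\<^sup>2 < (a * c - b)\<^sup>2" "0 \<le> a * c - b"
    using sq zero_le_power2 [of a] zero_le_power2 [of c] assms by linarith+
  then have "a < a * c - b" "c < a * c - b"
    by (blast intro: power2_less_imp_less)+
  moreover have "3 * (a * c - b) \<le> (a * c - b) * c" "3 * (a * c - b) \<le> a * (a * c - b)"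
    using assms \<open>0 \<le> a * c - b\<close>
      mult_right_mono [of 3 c "a * c - b"] mult_right_mono [of 3 a "a * c - b"]
    by (simp_all only: mult.commute)
  moreover have "2 * a < 3 * (a * c - b)" "2 * c < 3 * (a * c - b)"
  proof -
    have "2 * x < 3 * y" if "x < y" "3 \<le> x" for x y :: int
      using that by linarith
    then show "2 * a < 3 * (a * c - b)" "2 * c < 3 * (a * c - b)"
      using \<open>a < a * c - b\<close> \<open>c < a * c - b\<close> assms(1,3) by blast+
  qed
  ultimately show "2 * a < (a * c - b) * c" "2 * c < a * (a * c - b)"
    by (blast intro: less_le_trans)+
qed

text \<open>
  Closure under all Vieta moves, downward ones included: a downward move can only undo the last
  ascent. The moves in the three positions are treated together because a permutation
  exchanges them.
\<close>

lemma ascent_vieta_all: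
  assumes "ascent X"
  shows "ascent (vieta X) \<and> ascent (sigma1 (vieta (sigma1 X))) \<and> ascent (sigma2 (vieta (sigma2 X)))"
  using assms
proof induction
  case (root i j)
  have "ascent (vieta (s3_pow k * s1, s3_pow l * s1, s3_pow m * s1))" if "k + l + m = - 1" for k l m
  proof -
    have "l = - k - m - 1" using that by simp
    with ascent.root [of k m] show ?thesis by (auto intro: ascent.up)
  qed
  then show ?case by (auto simp: sigma1_def sigma2_def intro!: ascent.swap1 [unfolded sigma1_def] ascent.swap2 [unfolded sigma2_def]) 
next
  case (swap1 X)
  have "vieta (sigma1 X) = sigma1 (sigma1 (vieta (sigma1 X)))"
    "sigma2 (vieta (sigma2 (sigma1 X))) = sigma1 (sigma2 (vieta (sigma2 X)))"
    by (cases X; simp add: sigma1_def sigma2_def vieta_def mult.commute)+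
  with swap1 show ?case by (metis ascent.swap1 sigma_sigma(1))
next
  case (swap2 X)
  have "vieta (sigma2 X) = sigma2 (sigma2 (vieta (sigma2 X)))"
    "sigma1 (vieta (sigma1 (sigma2 X))) = sigma2 (sigma1 (vieta (sigma1 X)))"
    by (cases X; simp add: sigma1_def sigma2_def vieta_def mult.commute)+
  with swap2 show ?case by (metis ascent.swap2 sigma_sigma(2))
next
  case (up a b c)
  note asc = ascent.up [OF up.hyps]
  \<comment> \<open>The two permutations bring the first and the last entry into the middle position.\<close>
  have shifted: "ascent (a * c - star b, star a, star c)" "ascent (star a, star c, a * c - star b)"
    using ascent.swap1 [OF asc] ascent.swap2 [OF asc]
    by (simp_all add: vieta_def sigma1_def sigma2_def)
  have "ascent (vieta (a * c - star b, star a, star c))"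
    "ascent (vieta (star a, star c, a * c - star b))"
    using shifted ascent_ev [OF up.hyps(1)] up.hyps(2)
    by (auto intro!: ascent.up vieta_ascent_step)
  then have "ascent (sigma1 (vieta (sigma1 (vieta (a, b, c)))))"
    "ascent (sigma2 (vieta (sigma2 (vieta (a, b, c)))))"
    by (auto simp: vieta_def sigma1_def sigma2_def dest: ascent.swap1 ascent.swap2)
  with up.hyps(1) show ?case by simp
qed

lemma ascent_vieta: "ascent X \<Longrightarrow> ascent (vieta X)"
  using ascent_vieta_all by blast

text \<open>
  The scalings mu_act are normalized by the other moves; hence moves are well defined on classes
  modulo mu_act.
\<close>

lemma mu_act_conjugate:
  "mu_act i j (sigma1 X) = sigma1 (mu_act (- i - j) j X)"
  "mu_act i j (sigma2 X) = sigma2 (mu_act i (- i - j) X)"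
  "mu_act i j (vieta X) = vieta (mu_act (- i) (- j) X)"
proof -
  show "mu_act i j (sigma1 X) = sigma1 (mu_act (- i - j) j X)"
    "mu_act i j (sigma2 X) = sigma2 (mu_act i (- i - j) X)"
    by (cases X; simp add: mu_act_def sigma1_def sigma2_def)+
  obtain a b c where X: "X = (a, b, c)" by (cases X rule: prod_cases3)
  have "s3_pow (- i) * a * (s3_pow (- j) * c) = (s3_pow (- i) * s3_pow (- j)) * (a * c)"
    by (simp add: ac_simps)
  also have "\<dots> = s3_pow (- i - j) * (a * c)" by (simp add: s3_pow_mult)
  finally show "mu_act i j (vieta X) = vieta (mu_act (- i) (- j) X)"
    by (simp add: X mu_act_def vieta_def star_s3_pow right_diff_distrib)
qed

lemma ascent_mu_act: "ascent X \<Longrightarrow> ascent (mu_act i j X)"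
proof (induction X arbitrary: i j rule: ascent.induct)
  case (root k l)
  have "mu_act i j (s3_pow k * s1, s3_pow (- k - l - 1) * s1, s3_pow l * s1) =
      (s3_pow (i + k) * s1, s3_pow (- (i + k) - (j + l) - 1) * s1, s3_pow (j + l) * s1)"
    by (simp add: mu_act_def s3_pow_mult_left) (simp add: algebra_simps)
  then show ?case by (metis ascent.root)
next
  case (up a b c)
  have "ascent (mu_act (- i) (- j) (a, b, c))" by (rule up.IH)
  then show ?case unfolding mu_act_conjugate by (rule ascent_vieta)
qed (auto simp: mu_act_conjugate intro: ascent.swap1 ascent.swap2)

lemma lam_conjugate:
  "lam i j (sigma1 X) = sigma1 (lam (i + j) j X)"
  "lam i j (sigma2 X) = sigma2 (lam i (i + j) X)"
  "lam i j (vieta X) = vieta (lam i j X)"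
  "lam i j (mu_act k l X) = mu_act k l (lam i j X)"
  "lam i j (lam i' j' X) = lam (i + i') (j + j') X"
  by (cases X; cases "even i"; cases "even j"; cases "even i'"; cases "even j'";
      simp add: lam_def sigma1_def sigma2_def vieta_def mu_act_def)+

lemma orbit_ascent_up_to_sign:
  assumes "X \<in> Gamma_M_orbit"
  shows "\<exists>i j. ascent (lam i j X)"
  using assms
proof (induction X rule: Gamma_M_orbit_induct)
  case initial
  have "ascent (lam 0 0 initial_solution)"
    using ascent.root [of 0 0] by (simp add: lam_def initial_solution_def mult.commute)
  then show ?case by blast
next
  case (lam i j X)
  then obtain k l where "ascent (lam k l X)" by blast
  moreover have "lam (k + i) (l + j) (lam i j X) = lam k l X"
    by (metis lam_conjugate(5) lam_lam)
  ultimately show ?case by metis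
next
  case (sigma1 X)
  then obtain k l where "ascent (lam k l X)" by blast
  moreover have "lam (k + l) l (sigma1 X) = sigma1 (lam k l X)"
    by (cases X rule: prod_cases3) (simp add: lam_def sigma1_def uminus_power_if)
  ultimately show ?case by (metis ascent.swap1)
next
  case (sigma2 X)
  then obtain k l where "ascent (lam k l X)" by blast
  moreover have "lam k (k + l) (sigma2 X) = sigma2 (lam k l X)"
    by (cases X rule: prod_cases3) (simp add: lam_def sigma2_def uminus_power_if)
  ultimately show ?case by (metis ascent.swap2)
qed (metis lam_conjugate ascent_vieta ascent_mu_act)+

text \<open>
  Both X and some lam i j X have positive evaluation, so the signs of lam i j are trivial.
\<close>

lemma orbit_ascent:
  assumes "X \<in> Gamma_M_orbit" "Ev X = (a, b, c)" "0 < a" "0 < b" "0 < c"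
  shows "ascent X"
proof -
  obtain i j where asc: "ascent (lam i j X)"
    using orbit_ascent_up_to_sign [OF assms(1)] by blast
  obtain f g h where X: "X = (f, g, h)" by (cases X rule: prod_cases3)
  have "even i" "even j"
    using ascent_ev [OF asc [unfolded X lam_def prod.case]] assms(2-)
    by (cases "even i"; cases "even j"; force simp: X)+
  then show ?thesis using asc by (simp add: X lam_def)
qed

text \<open>
  The base of the comparison of fibres: nothing but the root lies over (3, 3, 3).
\<close>

lemma ascent_fibre_root:
  assumes "ascent X" "Ev X = (3, 3, 3)"
  shows "\<exists>i j. X = (s3_pow i * s1, s3_pow (- i - j - 1) * s1, s3_pow j * s1)"
  using assms
proof induction
  case (swap1 X)
  then have "Ev X = (3, 3, 3)" by (cases X rule: prod_cases3) (simp add: sigma1_def)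
  with swap1.IH obtain i j where "X = (s3_pow i * s1, s3_pow (- i - j - 1) * s1, s3_pow j * s1)"
    by blast
  then show ?case by (intro exI [of _ "- i - j - 1"] exI [of _ j]) (simp add: sigma1_def)
next
  case (swap2 X)
  then have "Ev X = (3, 3, 3)" by (cases X rule: prod_cases3) (simp add: sigma2_def)
  with swap2.IH obtain i j where "X = (s3_pow i * s1, s3_pow (- i - j - 1) * s1, s3_pow j * s1)"
    by blast
  then show ?case by (intro exI [of _ i] exI [of _ "- i - j - 1"]) (simp add: sigma2_def)
next
  case (up a b c)
  \<comment> \<open>Reaching (3, 3, 3) would need ev b = 3 * 3 - 3 = 6, which is not an ascent.\<close>
  then show ?case by (auto simp: vieta_def)
qed blast

text \<open>
  Undo the last step of X on both X and Y. The result of undoing it on Y is still an ascent by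
  closure under Vieta moves, whatever the construction of Y was, so the induction hypothesis
  applies.
\<close>

lemma ascent_fibre:
  assumes "ascent X" "ascent Y" "Ev Y = Ev X"
  shows "\<exists>i j. Y = mu_act i j X"
  using assms
proof (induction X arbitrary: Y rule: ascent.induct)
  case (root i j)
  then have "Ev Y = (3, 3, 3)" by simp
  with ascent_fibre_root root obtain k l
    where *: "Y = (s3_pow k * s1, s3_pow (- k - l - 1) * s1, s3_pow l * s1)"
    by blast
  have "Y = mu_act (k - i) (l - j) (s3_pow i * s1, s3_pow (- i - j - 1) * s1, s3_pow j * s1)"
  proof -
    have "- (k - i) - (l - j) + (- i - j - 1) = - k - l - 1" by simp
    then show ?thesis
      using * by (simp only: mu_act_def prod.case s3_pow_mult_left diff_add_cancel)
  qed
  then show ?case by blast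
next
  case (swap1 X)
  have "Ev (sigma1 Y) = Ev X"
    using swap1.prems by (cases X rule: prod_cases3; cases Y rule: prod_cases3) (auto simp: sigma1_def)
  then obtain i j where "sigma1 Y = mu_act i j X"
    using swap1 ascent.swap1 by blast
  then have "Y = sigma1 (mu_act i j X)" by (metis sigma_sigma(1))
  also have "\<dots> = mu_act (- i - j) j (sigma1 X)" by (simp add: mu_act_conjugate)
  finally show ?case by blast
next
  case (swap2 X)
  have "Ev (sigma2 Y) = Ev X"
    using swap2.prems by (cases X rule: prod_cases3; cases Y rule: prod_cases3) (auto simp: sigma2_def)
  then obtain i j where "sigma2 Y = mu_act i j X"
    using swap2 ascent.swap2 by blast
  then have "Y = sigma2 (mu_act i j X)" by (metis sigma_sigma(2))
  also have "\<dots> = mu_act i (- i - j) (sigma2 X)" by (simp add: mu_act_conjugate)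
  finally show ?case by blast
next
  case (up a b c)
  have "Ev (vieta Y) = Ev (a, b, c)"
    using up.prems by (cases Y rule: prod_cases3) (auto simp: vieta_def)
  then obtain i j where "vieta Y = mu_act i j (a, b, c)"
    using up ascent_vieta by blast
  then have "Y = vieta (mu_act i j (a, b, c))" by (metis vieta_vieta)
  also have "\<dots> = mu_act (- i) (- j) (vieta (a, b, c))" by (simp add: mu_act_conjugate)
  finally show ?case by blast
qed

lemma orbit_fibre:
  assumes "X \<in> Gamma_M_orbit" "Y \<in> Gamma_M_orbit" "Ev X = (a, b, c)" "Ev Y = (a, b, c)"
    "0 < a" "0 < b" "0 < c"
  shows "\<exists>i j. Y = mu_act i j X"
  using ascent_fibre [OF orbit_ascent orbit_ascent] assms by metis

section \<open>Degrees of products and of the involution\<close>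

text \<open>
  The components of lowest weight of f and g cannot cancel in the product, as polynomials over
  the integers form a domain. Concretely, break ties between keys of minimal weight by the
  lexicographic order: the sum of the two least keys then has a unique decomposition, and its
  coefficient in f * g is a product of two nonzero integers. With the exponent of s3 as weight
  this says that s3 is prime; with the negative degree it says that degrees add up.
\<close>

lemma keys_mult_minimal_weight:
  fixes f g :: A and w :: "nat \<times> nat \<times> int \<Rightarrow> int"
  assumes add: "\<And>m n. w (m + n) = w m + w n"
    and f: "\<exists>m\<in>Poly_Mapping.keys f. w m = u" "\<And>m. m \<in> Poly_Mapping.keys f \<Longrightarrow> u \<le> w m"
    and g: "\<exists>n\<in>Poly_Mapping.keys g. w n = v" "\<And>n. n \<in> Poly_Mapping.keys g \<Longrightarrow> v \<le> w n"
  shows "\<exists>p\<in>Poly_Mapping.keys (f * g). w p = u + v"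
proof -
  have least: "\<exists>m\<in>Poly_Mapping.keys h. w m = t \<and> (\<forall>m'\<in>Poly_Mapping.keys h. w m' = t \<longrightarrow> m \<le> m')"
    if "\<exists>m\<in>Poly_Mapping.keys h. w m = t" for h :: A and t
  proof -
    let ?M = "{m \<in> Poly_Mapping.keys h. w m = t}"
    have "finite ?M" "?M \<noteq> {}" using that by auto
    then have "Min ?M \<in> ?M" "\<forall>m'\<in>?M. Min ?M \<le> m'" using Min_in Min_le by blast+
    then show ?thesis by blast
  qed
  obtain m where m: "m \<in> Poly_Mapping.keys f" "w m = u"
    and m_least: "\<And>m'. m' \<in> Poly_Mapping.keys f \<Longrightarrow> w m' = u \<Longrightarrow> m \<le> m'"
    using least [OF f(1)] by blast
  obtain n where n: "n \<in> Poly_Mapping.keys g" "w n = v"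
    and n_least: "\<And>n'. n' \<in> Poly_Mapping.keys g \<Longrightarrow> w n' = v \<Longrightarrow> n \<le> n'"
    using least [OF g(1)] by blast
  have lex: "m' = m \<and> n' = n" if "m' + n' = m + n" "m \<le> m'" "n \<le> n'" for m' n'
    using that by (cases m; cases n; cases m'; cases n') (auto simp: less_eq_prod_def)
  have unique: "m' = m \<and> n' = n"
    if "m' \<in> Poly_Mapping.keys f" "n' \<in> Poly_Mapping.keys g" "m' + n' = m + n" for m' n'
  proof -
    have "w m' + w n' = u + v" using that(3) add m n by metis
    moreover have "u \<le> w m'" "v \<le> w n'" using f(2) g(2) that by blast+
    ultimately have "w m' = u" "w n' = v" by linarith+
    then show ?thesis using lex m_least n_least that by blast
  qed
  define c where "c = Poly_Mapping.lookup f m"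
  define d where "d = Poly_Mapping.lookup g n"
  define f' where "f' = f - Poly_Mapping.single m c"
  define g' where "g' = g - Poly_Mapping.single n d"
  have f': "Poly_Mapping.keys f' \<subseteq> Poly_Mapping.keys f - {m}"
    and g': "Poly_Mapping.keys g' \<subseteq> Poly_Mapping.keys g - {n}"
    by (rule subsetI, simp add: f'_def g'_def c_def d_def in_keys_iff lookup_minus lookup_single
        when_def split: if_splits)+
  have "m + n \<notin> Poly_Mapping.keys (f' * g)"
  proof
    assume "m + n \<in> Poly_Mapping.keys (f' * g)"
    then obtain m' n' where "m' \<in> Poly_Mapping.keys f'" "n' \<in> Poly_Mapping.keys g" "m + n = m' + n'"
      using keys_mult by blast
    then show False using f' unique [of m' n'] by auto
  qed
  moreover have "m + n \<notin> Poly_Mapping.keys (Poly_Mapping.single m c * g')"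
  proof
    assume "m + n \<in> Poly_Mapping.keys (Poly_Mapping.single m c * g')"
    then obtain m' n' where "m' \<in> Poly_Mapping.keys (Poly_Mapping.single m c)"
        "n' \<in> Poly_Mapping.keys g'" "m + n = m' + n'"
      using keys_mult by blast
    then show False using g' by (auto split: if_splits)
  qed
  moreover have "f * g = Poly_Mapping.single (m + n) (c * d) + Poly_Mapping.single m c * g' + f' * g"
  proof -
    have "f * g = x * y + x * (g - y) + (f - x) * g" for x y :: A
      by (simp add: right_diff_distrib left_diff_distrib)
    then show ?thesis by (simp only: f'_def g'_def flip: mult_single)
  qed
  ultimately have "Poly_Mapping.lookup (f * g) (m + n) = c * d"
    by (simp only: lookup_add in_keys_iff lookup_single_eq) simp
  also have "\<dots> \<noteq> 0" using m n by (simp add: c_def d_def in_keys_iff)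
  finally have "m + n \<in> Poly_Mapping.keys (f * g)" by (simp add: in_keys_iff)
  moreover have "w (m + n) = u + v" using add m n by simp
  ultimately show ?thesis by blast
qed

definition s3_free_polynomial :: "A \<Rightarrow> bool" where
  "s3_free_polynomial f \<longleftrightarrow> is_polynomial f \<and> \<not> s3_divides f"

lemma s3_free_polynomial_iff:
  "s3_free_polynomial f \<longleftrightarrow>
    (\<forall>i j k. (i, j, k) \<in> Poly_Mapping.keys f \<longrightarrow> 0 \<le> k) \<and> (\<exists>i j. (i, j, 0) \<in> Poly_Mapping.keys f)"
proof -
  have "s3_divides f \<longleftrightarrow> (\<forall>i j k. (i, j, k) \<in> Poly_Mapping.keys f \<longrightarrow> 1 \<le> k)"
  proof
    assume "s3_divides f"
    then obtain g where g: "is_polynomial g" "f = s3 * g" by (auto simp: s3_divides_def)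
    have "1 \<le> k" if "(i, j, k) \<in> Poly_Mapping.keys f" for i j k
    proof -
      have "(i, j, k - 1) \<in> Poly_Mapping.keys g"
        using that by (simp add: in_keys_iff g(2) lookup_s3_pow_mult)
      then show ?thesis using g(1) by (force simp: is_polynomial_def)
    qed
    then show "\<forall>i j k. (i, j, k) \<in> Poly_Mapping.keys f \<longrightarrow> 1 \<le> k" by blast
  next
    assume *: "\<forall>i j k. (i, j, k) \<in> Poly_Mapping.keys f \<longrightarrow> 1 \<le> k"
    have "0 \<le> k" if "(i, j, k) \<in> Poly_Mapping.keys (s3_inv * f)" for i j k
    proof -
      have "(i, j, k + 1) \<in> Poly_Mapping.keys f"
        using that by (simp add: in_keys_iff lookup_s3_pow_mult)
      then show ?thesis using * by force
    qed
    then have "is_polynomial (s3_inv * f)" by (auto simp: is_polynomial_def)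
    moreover have "f = s3 * (s3_inv * f)" by (simp add: s3_pow_mult_left)
    ultimately show "s3_divides f" unfolding s3_divides_def by blast
  qed
  moreover have "is_polynomial f \<longleftrightarrow> (\<forall>i j k. (i, j, k) \<in> Poly_Mapping.keys f \<longrightarrow> 0 \<le> k)"
    by (auto simp: is_polynomial_def)
  moreover have "k = 0 \<longleftrightarrow> 0 \<le> k \<and> \<not> 1 \<le> k" for k :: int
    by linarith
  ultimately show ?thesis
    unfolding s3_free_polynomial_def by metis
qed

lemma s3_free_polynomial_nonzero: "s3_free_polynomial f \<Longrightarrow> f \<noteq> 0"
  by (auto simp: s3_free_polynomial_iff)

lemma weighted_degree_ge:
  "m \<in> Poly_Mapping.keys f \<Longrightarrow> monom_weight w m \<le> weighted_degree w f"
  by (simp add: weighted_degree_def)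

lemma weighted_degree_attained:
  assumes "f \<noteq> 0"
  shows "\<exists>m\<in>Poly_Mapping.keys f. monom_weight w m = weighted_degree w f"
proof -
  let ?W = "monom_weight w ` Poly_Mapping.keys f"
  have "?W \<noteq> {}" using assms by simp
  moreover from this have "weighted_degree w f = Max ?W"
    by (simp add: weighted_degree_def)
  ultimately have "weighted_degree w f \<in> ?W" by (metis Max_in finite_imageI finite_keys)
  then show ?thesis by (metis imageE)
qed

lemma weighted_degree_eqI:
  assumes "m \<in> Poly_Mapping.keys f" "monom_weight w m = d"
    "\<And>m. m \<in> Poly_Mapping.keys f \<Longrightarrow> monom_weight w m \<le> d"
  shows "weighted_degree w f = d"
  unfolding weighted_degree_def
proof (rule Max_eqI)
  show "d \<in> insert 0 (monom_weight w ` Poly_Mapping.keys f)" using assms(1,2) by blast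
qed (use assms(3) in auto)

lemma s3_free_mult:
  assumes "s3_free_polynomial f" "s3_free_polynomial g"
  shows "s3_free_polynomial (f * g)"
proof -
  have "\<exists>p\<in>Poly_Mapping.keys (f * g). snd (snd p) = 0 + 0"
    by (rule keys_mult_minimal_weight) (use assms in \<open>force simp: s3_free_polynomial_iff\<close>)+
  moreover have "0 \<le> k" if "(i, j, k) \<in> Poly_Mapping.keys (f * g)" for i j k
    using that keys_mult [of f g] assms by (force simp: s3_free_polynomial_iff)
  ultimately show ?thesis by (force simp: s3_free_polynomial_iff)
qed

text \<open>
  Integer-valued and additive on all exponent vectors, including those with negative powers
  of s3, where monom_weight truncates.
\<close>

definition total_degree :: "nat \<times> nat \<times> int \<Rightarrow> int" where
  "total_degree = (\<lambda>(i, j, k). int i + int j + k)"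

definition quasi_degree :: "nat \<times> nat \<times> int \<Rightarrow> int" where
  "quasi_degree = (\<lambda>(i, j, k). int i + 2 * int j + 3 * k)"

lemma total_degree_add: "total_degree (m + n) = total_degree m + total_degree n"
  and quasi_degree_add: "quasi_degree (m + n) = quasi_degree m + quasi_degree n"
  by (cases m; cases n; simp add: total_degree_def quasi_degree_def)+

lemma monom_weight_polynomial:
  assumes "is_polynomial f" "m \<in> Poly_Mapping.keys f"
  shows "int (monom_weight (1, 1, 1) m) = total_degree m"
    and "int (monom_weight (1, 2, 3) m) = quasi_degree m"
proof -
  obtain i j k where m: "m = (i, j, k)" by (cases m)
  then have "0 \<le> k" using assms by (auto simp: is_polynomial_def)
  then show "int (monom_weight (1, 1, 1) m) = total_degree m"
    "int (monom_weight (1, 2, 3) m) = quasi_degree m"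
    by (simp_all add: m monom_weight_def total_degree_def quasi_degree_def)
qed

lemma deg_iff:
  assumes "is_polynomial f" "f \<noteq> 0"
  shows "deg f = d \<longleftrightarrow> (\<exists>m\<in>Poly_Mapping.keys f. total_degree m = int d) \<and>
    (\<forall>m\<in>Poly_Mapping.keys f. total_degree m \<le> int d)"
proof
  assume "deg f = d"
  then show "(\<exists>m\<in>Poly_Mapping.keys f. total_degree m = int d) \<and>
      (\<forall>m\<in>Poly_Mapping.keys f. total_degree m \<le> int d)"
    using weighted_degree_attained [OF assms(2)] weighted_degree_ge monom_weight_polynomial(1) [OF assms(1)]
    unfolding deg_def by (metis of_nat_mono)
next
  assume *: "(\<exists>m\<in>Poly_Mapping.keys f. total_degree m = int d) \<and>
      (\<forall>m\<in>Poly_Mapping.keys f. total_degree m \<le> int d)"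
  then obtain m where m: "m \<in> Poly_Mapping.keys f" "total_degree m = int d" by blast
  show "deg f = d"
    unfolding deg_def
  proof (rule weighted_degree_eqI [OF m(1)])
    show "monom_weight (1, 1, 1) m = d"
      using monom_weight_polynomial(1) [OF assms(1) m(1)] m(2) by linarith
    show "monom_weight (1, 1, 1) n \<le> d" if "n \<in> Poly_Mapping.keys f" for n
      using monom_weight_polynomial(1) [OF assms(1) that] * that by force
  qed
qed

lemma quasi_homogeneous_Deg_iff:
  assumes "is_polynomial f" "f \<noteq> 0"
  shows "quasi_homogeneous f \<and> Deg f = q \<longleftrightarrow>
    (\<forall>m\<in>Poly_Mapping.keys f. quasi_degree m = int q)"
proof
  assume "quasi_homogeneous f \<and> Deg f = q"
  moreover obtain m where "m \<in> Poly_Mapping.keys f" "monom_weight (1, 2, 3) m = Deg f"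
    unfolding Deg_def using weighted_degree_attained [OF assms(2)] by blast
  ultimately show "\<forall>m\<in>Poly_Mapping.keys f. quasi_degree m = int q"
    unfolding quasi_homogeneous_def using monom_weight_polynomial(2) [OF assms(1)] by metis
next
  assume *: "\<forall>m\<in>Poly_Mapping.keys f. quasi_degree m = int q"
  then have w: "\<forall>m\<in>Poly_Mapping.keys f. monom_weight (1, 2, 3) m = q"
    using monom_weight_polynomial(2) [OF assms(1)] by (metis of_nat_eq_iff)
  moreover obtain m where "m \<in> Poly_Mapping.keys f"
    using assms(2) keys_eq_empty by blast
  ultimately have "Deg f = q"
    unfolding Deg_def by (intro weighted_degree_eqI) auto
  with w show "quasi_homogeneous f \<and> Deg f = q"
    unfolding quasi_homogeneous_def by blast
qed

text \<open>
  A polynomial of degree 0 has only the zero exponent vector as a possible key.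
\<close>

lemma nonconstant_iff_deg_pos:
  assumes "s3_free_polynomial f"
  shows "nonconstant f \<longleftrightarrow> 0 < deg f"
proof -
  have f: "is_polynomial f" "f \<noteq> 0"
    using assms s3_free_polynomial_nonzero by (auto simp: s3_free_polynomial_def)
  have "deg f = 0" if "f = of_int c" for c
  proof -
    have f0: "f = Poly_Mapping.single 0 c"
      unfolding that by (subst single_of_int [symmetric]) simp
    then have "c \<noteq> 0" using f(2) by auto
    then show ?thesis
      by (subst deg_iff [OF f]) (simp add: f0 total_degree_def zero_prod_def)
  qed
  moreover have "f = of_int (Poly_Mapping.lookup f 0)" if "deg f = 0"
  proof -
    have "m = 0" if m: "m \<in> Poly_Mapping.keys f" for m
    proof -
      obtain i j k where ijk: "m = (i, j, k)" by (cases m)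
      have "total_degree m \<le> 0" "0 \<le> k"
        using \<open>deg f = 0\<close> deg_iff [OF f, of 0] m f(1) by (auto simp: ijk is_polynomial_def)
      then show ?thesis by (auto simp: ijk total_degree_def zero_prod_def)
    qed
    then have "f = Poly_Mapping.single 0 (Poly_Mapping.lookup f 0)"
      by (intro poly_mapping_eqI) (metis in_keys_iff lookup_single_eq lookup_single_not_eq)
    also have "\<dots> = of_int (Poly_Mapping.lookup f 0)"
      by (subst single_of_int [symmetric]) simp
    finally show ?thesis .
  qed
  ultimately show ?thesis unfolding nonconstant_def by (metis gr0I less_irrefl)
qed

lemma mu_eq: "mu f = s3_pow (int (deg f)) * star f"
  by (simp add: mu_def star_def s3_power)

text \<open>
  On keys mu is the reflection that trades the exponent of s3 for the defect from
  the top degree.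
\<close>

lemma mu_key_iff:
  "(i, j, k) \<in> Poly_Mapping.keys (mu f) \<longleftrightarrow>
    (j, i, int (deg f) - int i - int j - k) \<in> Poly_Mapping.keys f"
  by (simp add: in_keys_iff mu_eq lookup_s3_pow_mult lookup_star) (simp add: algebra_simps)

text \<open>
  Under the reflection of keys, terms of top degree become terms without s3, and terms without s3
  become terms of top degree. For a polynomial not divisible by s3 both kinds are
  present, so mu f is of the same form and of the same degree.
\<close>

lemma
  assumes f: "s3_free_polynomial f"
  shows s3_free_mu: "s3_free_polynomial (mu f)"
    and deg_mu: "deg (mu f) = deg f"
    and quasi_homogeneous_mu:
      "quasi_homogeneous f \<Longrightarrow> quasi_homogeneous (mu f) \<and> Deg (mu f) + Deg f = 3 * deg f"
proof -
  have pf: "is_polynomial f" "f \<noteq> 0"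
    using f s3_free_polynomial_nonzero by (auto simp: s3_free_polynomial_def)
  have top: "\<exists>m\<in>Poly_Mapping.keys f. total_degree m = int (deg f)"
    "\<forall>m\<in>Poly_Mapping.keys f. total_degree m \<le> int (deg f)"
    using deg_iff [OF pf] by blast+
  have bound: "int i + int j + k \<le> int (deg f) \<and> 0 \<le> k"
    if "(i, j, k) \<in> Poly_Mapping.keys f" for i j k
    using top(2) that f by (force simp: total_degree_def s3_free_polynomial_iff)
  obtain i j k where "(i, j, k) \<in> Poly_Mapping.keys f" "int i + int j + k = int (deg f)"
    using top(1) by (auto simp: total_degree_def)
  then have "(j, i, 0) \<in> Poly_Mapping.keys (mu f)"
    by (auto simp: mu_key_iff dest!: sym [of _ "int (deg f)"])
  moreover have "0 \<le> k" if "(i, j, k) \<in> Poly_Mapping.keys (mu f)" for i j k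
    using bound that by (force simp: mu_key_iff)
  ultimately show free: "s3_free_polynomial (mu f)"
    by (auto simp: s3_free_polynomial_iff)
  then have pm: "is_polynomial (mu f)" "mu f \<noteq> 0"
    using s3_free_polynomial_nonzero by (auto simp: s3_free_polynomial_def)
  obtain i j where ij: "(i, j, 0) \<in> Poly_Mapping.keys f"
    using f by (auto simp: s3_free_polynomial_iff)
  have "(j, i, int (deg f) - int i - int j) \<in> Poly_Mapping.keys (mu f)"
    using ij by (simp add: mu_key_iff)
  moreover have "total_degree m \<le> int (deg f)" if "m \<in> Poly_Mapping.keys (mu f)" for m
    using that bound by (cases m) (force simp: mu_key_iff total_degree_def)
  ultimately show "deg (mu f) = deg f"
    by (subst deg_iff [OF pm]) (force simp: total_degree_def)
  assume qh: "quasi_homogeneous f"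
  then have q: "\<forall>m\<in>Poly_Mapping.keys f. quasi_degree m = int (Deg f)"
    using quasi_homogeneous_Deg_iff [OF pf] by blast
  have q_mu: "quasi_degree m = 3 * int (deg f) - int (Deg f)"
    if "m \<in> Poly_Mapping.keys (mu f)" for m
    using that q by (cases m) (force simp: mu_key_iff quasi_degree_def)
  moreover have "0 \<le> 3 * int (deg f) - int (Deg f)"
    using q bound ij by (force simp: quasi_degree_def)
  ultimately have "quasi_homogeneous (mu f) \<and> Deg (mu f) = 3 * deg f - Deg f"
    by (subst quasi_homogeneous_Deg_iff [OF pm]) (simp add: of_nat_diff)
  with \<open>0 \<le> _\<close> show "quasi_homogeneous (mu f) \<and> Deg (mu f) + Deg f = 3 * deg f"
    by simp
qed

section \<open>The mutation step\<close>

lemma admissible_iff: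
  "admissible (f1, f2, f3) \<longleftrightarrow>
    s3_free_polynomial f1 \<and> s3_free_polynomial f2 \<and> s3_free_polynomial f3 \<and>
    quasi_homogeneous f1 \<and> quasi_homogeneous f2 \<and> quasi_homogeneous f3 \<and>
    deg f2 = deg f1 + deg f3 \<and> Deg f2 = Deg f1 + Deg f3"
  by (auto simp: s3_free_polynomial_def bidegree_def)

text \<open>
  The product mu f1 * f2 and the correction s3^(deg f1) f3 are quasi-homogeneous of the same
  quasi-degree, as Deg (mu f1) + Deg f2 = 3 deg f1 + Deg f3. The correction has smaller degree,
  deg f1 + deg f3 = deg f2 < deg f1 + deg f2, and is divisible by s3; so neither the degree of the
  difference nor its divisibility by s3 is affected by it.
\<close>

lemma admissible_mutation:
  assumes adm: "admissible (f1, f2, f3)" and d1: "0 < deg f1"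
  shows "admissible (mu f1, mu f1 * f2 - s3 ^ deg f1 * f3, f2)"
proof -
  note adm' = adm [unfolded admissible_iff]
  let ?d = "int (deg f1)" and ?h = "mu f1 * f2" and ?r = "s3_pow (int (deg f1)) * f3"
  let ?g = "mu f1 * f2 - s3_pow (int (deg f1)) * f3"
  have free: "s3_free_polynomial f1" "s3_free_polynomial f2" "s3_free_polynomial f3"
    "s3_free_polynomial (mu f1)"
    using adm' s3_free_mu by blast+
  then have poly: "is_polynomial f1" "is_polynomial f2" "is_polynomial f3" "is_polynomial (mu f1)"
    and nz: "f1 \<noteq> 0" "f2 \<noteq> 0" "f3 \<noteq> 0" "mu f1 \<noteq> 0"
    using s3_free_polynomial_nonzero by (auto simp: s3_free_polynomial_def)
  have mu1: "deg (mu f1) = deg f1" "quasi_homogeneous (mu f1)" "Deg (mu f1) + Deg f1 = 3 * deg f1"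
    using adm' deg_mu quasi_homogeneous_mu by blast+
  have r_key: "(i, j, k - ?d) \<in> Poly_Mapping.keys f3" if "(i, j, k) \<in> Poly_Mapping.keys ?r" for i j k
    using that by (simp add: in_keys_iff lookup_s3_pow_mult)
  have g_key: "m \<in> Poly_Mapping.keys ?h \<or> m \<in> Poly_Mapping.keys ?r"
    if "m \<in> Poly_Mapping.keys ?g" for m
    using that keys_diff [of ?h ?r] by blast
  have g_keyI: "m \<in> Poly_Mapping.keys ?g"
    if "m \<in> Poly_Mapping.keys ?h" "m \<notin> Poly_Mapping.keys ?r" for m
    using that by (simp add: in_keys_iff lookup_minus)
  have h_free: "s3_free_polynomial ?h"
    using free by (intro s3_free_mult)
  have r_pos: "?d \<le> k" if "(i, j, k) \<in> Poly_Mapping.keys ?r" for i j k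
    using r_key [OF that] free(3) by (force simp: s3_free_polynomial_iff)
  have g_free: "s3_free_polynomial ?g"
  proof -
    obtain i j where "(i, j, 0) \<in> Poly_Mapping.keys ?h"
      using h_free by (auto simp: s3_free_polynomial_iff)
    then have "(i, j, 0) \<in> Poly_Mapping.keys ?g"
      using g_keyI r_pos d1 by force
    moreover have "0 \<le> k" if "(i, j, k) \<in> Poly_Mapping.keys ?g" for i j k
      using g_key [OF that] h_free r_pos by (force simp: s3_free_polynomial_iff)
    ultimately show ?thesis by (auto simp: s3_free_polynomial_iff)
  qed
  then have pg: "is_polynomial ?g" "?g \<noteq> 0"
    using s3_free_polynomial_nonzero [OF g_free] by (simp_all add: s3_free_polynomial_def)
  have r_deg: "total_degree m \<le> int (deg f1 + deg f3)" if "m \<in> Poly_Mapping.keys ?r" for m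
  proof -
    obtain i j k where m: "m = (i, j, k)" by (cases m)
    have "total_degree (i, j, k - ?d) \<le> int (deg f3)"
      using r_key that deg_iff [OF poly(3) nz(3), of "deg f3"] unfolding m by blast
    then show ?thesis by (simp add: m total_degree_def)
  qed
  have h_deg: "total_degree m \<le> int (deg f1 + deg f2)" if hm: "m \<in> Poly_Mapping.keys ?h" for m
  proof -
    obtain n n' where "n \<in> Poly_Mapping.keys (mu f1)" "n' \<in> Poly_Mapping.keys f2" "m = n + n'"
      using hm keys_mult by blast
    then show ?thesis
      using deg_iff [OF poly(2) nz(2), of "deg f2"] deg_iff [OF poly(4) nz(4), of "deg f1"] mu1(1)
      by (simp add: total_degree_add add_mono)
  qed
  \<comment> \<open>Minimal weight for the negative degree is maximal degree.\<close>
  have "\<exists>p\<in>Poly_Mapping.keys ?h. - total_degree p = - int (deg f1) + - int (deg f2)"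
    using deg_iff [OF poly(2) nz(2), of "deg f2"] deg_iff [OF poly(4) nz(4), of "deg f1"] mu1
    by (intro keys_mult_minimal_weight) (auto simp: total_degree_add)
  then obtain p where p: "p \<in> Poly_Mapping.keys ?h" "total_degree p = int (deg f1 + deg f2)"
    by auto
  have "p \<notin> Poly_Mapping.keys ?r"
    using r_deg [of p] p adm' d1 by auto
  then have "p \<in> Poly_Mapping.keys ?g" using p g_keyI by blast
  moreover have "total_degree m \<le> int (deg f1 + deg f2)" if "m \<in> Poly_Mapping.keys ?g" for m
    using g_key [OF that] h_deg [of m] r_deg [of m] adm' by auto
  ultimately have g_deg: "deg ?g = deg f1 + deg f2"
    using p by (subst deg_iff [OF pg]) auto
  have "quasi_degree m = int (Deg (mu f1) + Deg f2)" if "m \<in> Poly_Mapping.keys ?g" for m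
    using g_key [OF that]
  proof
    assume "m \<in> Poly_Mapping.keys ?h"
    then obtain n n' where "n \<in> Poly_Mapping.keys (mu f1)" "n' \<in> Poly_Mapping.keys f2" "m = n + n'"
      using keys_mult by blast
    moreover have "\<forall>n\<in>Poly_Mapping.keys (mu f1). quasi_degree n = int (Deg (mu f1))"
      "\<forall>n\<in>Poly_Mapping.keys f2. quasi_degree n = int (Deg f2)"
      using quasi_homogeneous_Deg_iff [OF poly(2) nz(2)]
        quasi_homogeneous_Deg_iff [OF poly(4) nz(4)] mu1(2) adm' by blast+
    ultimately show ?thesis by (simp add: quasi_degree_add)
  next
    assume r: "m \<in> Poly_Mapping.keys ?r"
    obtain i j k where m: "m = (i, j, k)" by (cases m)
    have "quasi_degree (i, j, k - ?d) = int (Deg f3)"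
      using r_key r quasi_homogeneous_Deg_iff [OF poly(3) nz(3), of "Deg f3"] adm' unfolding m
      by blast
    then show ?thesis using mu1(3) adm' by (simp add: m quasi_degree_def)
  qed
  then have "quasi_homogeneous ?g \<and> Deg ?g = Deg (mu f1) + Deg f2"
    by (subst quasi_homogeneous_Deg_iff [OF pg]) blast
  then show ?thesis
    using free g_free g_deg mu1 adm' by (simp add: admissible_iff s3_power del: admissible.simps)
qed

section \<open>Descent in the tree of Markov triples\<close>

text \<open>
  For a = 1 or a = 2 the equation makes a sum of squares negative.
\<close>

lemma markov_entry_ge_3:
  fixes a b c :: int
  assumes "0 < a" "0 < b" "0 < c" "a\<^sup>2 + b\<^sup>2 + c\<^sup>2 = a * b * c"
  shows "3 \<le> a"
proof (rule ccontr)
  assume "\<not> 3 \<le> a"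
  then consider "a = 1" | "a = 2" using assms by linarith
  then show False
  proof cases
    case 1
    then have "b\<^sup>2 + c\<^sup>2 + (b - c)\<^sup>2 + 2 = 0"
      using assms(4) by (simp add: power2_eq_square algebra_simps)
    then show False using zero_le_power2 [of b] zero_le_power2 [of c] zero_le_power2 [of "b - c"] by linarith
  next
    case 2
    then have "(b - c)\<^sup>2 + 4 = 0"
      using assms(4) by (simp add: power2_eq_square algebra_simps)
    then show False using zero_le_power2 [of "b - c"] by linarith
  qed
qed

text \<open>
  Here b is a multiple k of a, and the equation becomes 2 + k^2 = k a, so k divides 2;
  and k > 1 as a < b.
\<close>

lemma markov_isosceles:
  fixes a b :: int
  assumes "0 < a" "a < b" "a\<^sup>2 + b\<^sup>2 + a\<^sup>2 = a * b * a"
  shows "a = 3 \<and> b = 6"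
proof -
  have "b\<^sup>2 = a\<^sup>2 * (b - 2)"
    using assms(3) by (simp add: power2_eq_square algebra_simps)
  then have "a\<^sup>2 dvd b\<^sup>2" by simp
  then have "a dvd b" by (simp add: pow_divides_pow_iff)
  then obtain k where k: "b = a * k" by blast
  then have "1 < k" using assms by (metis mult.right_neutral mult_less_cancel_left_pos)
  have "a\<^sup>2 * (2 + k\<^sup>2) = a\<^sup>2 * (k * a)"
    using assms(3) by (simp add: k power2_eq_square algebra_simps)
  then have eq: "2 + k\<^sup>2 = k * a" using assms(1) by simp
  then have "k dvd 2" by (metis dvd_add_times_triv_right_iff dvd_triv_left power2_eq_square)
  then have "k \<le> 2" using zdvd_imp_le by simp
  with \<open>1 < k\<close> have "k = 2" by simp
  with eq k show ?thesis by simp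
qed

text \<open>
  The numbers b and ac - b are the roots of x^2 - acx + a^2 + c^2. At x = c this polynomial
  is negative, so c lies strictly between them. That the new largest entry c is at least 6
  excludes finitely many triples.
\<close>

lemma markov_descent:
  fixes a b c :: int
  assumes "0 < a" "a < c" "c < b" and eq: "a\<^sup>2 + b\<^sup>2 + c\<^sup>2 = a * b * c"
  shows "a\<^sup>2 + c\<^sup>2 + (a * c - b)\<^sup>2 = a * c * (a * c - b)" "0 < a * c - b" "a * c - b < c" "6 \<le> c"
proof -
  show eq': "a\<^sup>2 + c\<^sup>2 + (a * c - b)\<^sup>2 = a * c * (a * c - b)"
    using eq by (simp add: power2_eq_square algebra_simps)
  have prod: "b * (a * c - b) = a\<^sup>2 + c\<^sup>2"
    using eq by (simp add: power2_eq_square algebra_simps)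
  then have "0 < b * (a * c - b)"
    using assms by (simp add: pos_add_strict)
  then show pos: "0 < a * c - b"
    using assms by (simp add: zero_less_mult_iff)
  have a3: "3 \<le> a"
    by (rule markov_entry_ge_3 [OF _ _ _ eq]) (use assms in linarith)+
  have "(c - b) * (c - (a * c - b)) = a\<^sup>2 + c\<^sup>2 - (a - 1) * c\<^sup>2"
  proof -
    have "(c - b) * (c - (a * c - b)) = c\<^sup>2 - a * c\<^sup>2 + b * (a * c - b)"
      by (simp add: power2_eq_square algebra_simps)
    then show ?thesis unfolding prod by (simp add: left_diff_distrib)
  qed
  moreover have "a\<^sup>2 < c\<^sup>2"
    using assms by (intro power_strict_mono) auto
  moreover have "2 * c\<^sup>2 \<le> (a - 1) * c\<^sup>2"
    using a3 by (intro mult_right_mono) auto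
  ultimately have "(c - b) * (c - (a * c - b)) < 0" by linarith
  then show lt: "a * c - b < c"
    using assms by (simp add: mult_less_0_iff)
  show "6 \<le> c"
  proof (rule ccontr)
    define d where "d = a * c - b"
    assume "\<not> 6 \<le> c"
    have "3 \<le> d"
      using markov_entry_ge_3 [of d a c] eq' assms pos by (simp add: d_def ac_simps)
    have d: "d < c" "a\<^sup>2 + c\<^sup>2 + d\<^sup>2 = a * c * d"
      using lt eq' by (simp_all add: d_def)
    have "c = 4 \<or> c = 5" "a = 3 \<or> a = 4" "d = 3 \<or> d = 4"
      using a3 assms(2) \<open>\<not> 6 \<le> c\<close> \<open>3 \<le> d\<close> d(1) by linarith+
    then show False using assms(2) d by (elim disjE) simp_all
  qed
qed

section \<open>Reduced polynomial presentations\<close>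

text \<open>
  The invariant carried through the tree: everything that one mutation step needs in order to
  be applied again.
\<close>

definition admissible_presentation :: "A \<times> A \<times> A \<Rightarrow> int \<times> int \<times> int \<Rightarrow> bool" where
  "admissible_presentation = (\<lambda>(f1, f2, f3) t.
     (star f1, f2, star f3) \<in> Gamma_M_orbit \<and> Ev (star f1, f2, star f3) = t \<and>
     admissible (f1, f2, f3) \<and> 0 < deg f1 \<and> 0 < deg f3)"

lemma admissible_presentation_reverse:
  assumes "admissible_presentation (f1, f2, f3) (a, b, c)"
  shows "admissible_presentation (f3, f2, f1) (c, b, a)"
proof -
  have "sigma1 (sigma2 (sigma1 (star f1, f2, star f3))) \<in> Gamma_M_orbit"
    using assms by (intro Gamma_M_orbit_closed) (simp add: admissible_presentation_def)
  then show ?thesis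
    using assms unfolding admissible_presentation_def admissible_iff prod.case
    by (simp add: sigma1_def sigma2_def add.commute)
qed

text \<open>
  The triple is the image of (f1*, f2, f3*) under exchanging the last two entries, a Vieta move,
  and multiplication of the first entry by s3^(-deg f1), the second by s3^(deg f1).
\<close>

lemma mutation_in_orbit:
  assumes "(star f1, f2, star f3) \<in> Gamma_M_orbit"
  shows "(star (mu f1), mu f1 * f2 - s3 ^ deg f1 * f3, star f2) \<in> Gamma_M_orbit"
proof -
  have "mu_act (- int (deg f1)) 0 (vieta (sigma2 (star f1, f2, star f3))) \<in> Gamma_M_orbit"
    using assms by (intro Gamma_M_orbit_closed)
  then show ?thesis
    by (simp add: mu_act_def vieta_def sigma2_def mu_eq star_s3_pow s3_power right_diff_distrib mult.assoc)
qed

lemma admissible_presentation_mutation: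
  assumes "admissible_presentation (f1, f2, f3) (a, b, c)"
  shows "admissible_presentation
    (mu f1, mu f1 * f2 - s3 ^ deg f1 * f3, f2) (a, a * b - c, b)"
proof -
  have pres: "(star f1, f2, star f3) \<in> Gamma_M_orbit" "admissible (f1, f2, f3)"
      "0 < deg f1" "0 < deg f3" "ev f1 = a" "ev f2 = b" "ev f3 = c"
    using assms by (simp_all add: admissible_presentation_def del: admissible.simps)
  moreover have "0 < deg (mu f1)" "0 < deg f2"
    using pres by (auto simp: admissible_iff deg_mu simp del: admissible.simps)
  moreover have "ev (mu f1) = a"
    by (simp add: mu_eq \<open>ev f1 = a\<close>)
  ultimately show ?thesis
    using mutation_in_orbit [OF pres(1)] admissible_mutation [OF pres(2,3)]
    by (simp add: admissible_presentation_def del: admissible.simps)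
qed

lemma admissible_presentation_3_6_3:
  "admissible_presentation (s1, s1\<^sup>2 - s2, s1) (3, 6, 3)"
proof -
  have orbit: "(star s1, s1\<^sup>2 - s2, star s1) \<in> Gamma_M_orbit"
    using Gamma_M_orbit_closed(5) [OF initial_solution_in_orbit]
    by (simp add: initial_solution_def vieta_def star_s1 star_s3_pow s3_pow_mult power2_eq_square mult.assoc)
  have s1: "s3_free_polynomial s1" "quasi_homogeneous s1 \<and> Deg s1 = 1" "deg s1 = 1"
  proof -
    have keys: "Poly_Mapping.keys s1 = {(1, 0, 0)}" by (simp add: s1_def)
    then show free: "s3_free_polynomial s1" by (simp add: s3_free_polynomial_iff)
    note pf = free [unfolded s3_free_polynomial_def, THEN conjunct1] s3_free_polynomial_nonzero [OF free]
    show "quasi_homogeneous s1 \<and> Deg s1 = 1"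
      by (subst quasi_homogeneous_Deg_iff [OF pf]) (simp add: keys quasi_degree_def)
    show "deg s1 = 1"
      by (subst deg_iff [OF pf]) (simp add: keys total_degree_def)
  qed
  have s1_sq: "s3_free_polynomial (s1\<^sup>2 - s2)" "quasi_homogeneous (s1\<^sup>2 - s2) \<and> Deg (s1\<^sup>2 - s2) = 2"
    "deg (s1\<^sup>2 - s2) = 2"
  proof -
    have keys: "Poly_Mapping.keys (s1\<^sup>2 - s2) = {(2, 0, 0), (0, 1, 0)}"
      by (auto simp: in_keys_iff s1_def s2_def single_mult_power lookup_minus lookup_single when_def
          split: if_splits)
    then show free: "s3_free_polynomial (s1\<^sup>2 - s2)" by (auto simp: s3_free_polynomial_iff)
    note pf = free [unfolded s3_free_polynomial_def, THEN conjunct1] s3_free_polynomial_nonzero [OF free]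
    show "quasi_homogeneous (s1\<^sup>2 - s2) \<and> Deg (s1\<^sup>2 - s2) = 2"
      by (subst quasi_homogeneous_Deg_iff [OF pf]) (simp add: keys quasi_degree_def)
    show "deg (s1\<^sup>2 - s2) = 2"
      by (subst deg_iff [OF pf]) (simp add: keys total_degree_def)
  qed
  show ?thesis
    unfolding admissible_presentation_def prod.case admissible_iff
    using orbit s1 s1_sq by simp
qed

text \<open>
  Induction on the largest entry. By reversing the triple, a \<le> c may be assumed; if a = c the triple is
  (3, 6, 3), and otherwise it is the mutation of the smaller triple (a, c, ac - b).
\<close>

lemma admissible_presentation_exists:
  assumes "markov_triple (a, b, c)" "a < b" "c < b" "6 \<le> b"
  shows "\<exists>f. admissible_presentation f (a, b, c)"
  using assms
proof (induction "nat b" arbitrary: a b c rule: less_induct)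
  case less
  have ordered: "\<exists>f. admissible_presentation f (a', b, c')"
    if "a' \<le> c'" "c' < b" "0 < a'" "a'\<^sup>2 + b\<^sup>2 + c'\<^sup>2 = a' * b * c'" for a' c'
  proof (cases "a' = c'")
    case True
    then have "a' = 3 \<and> b = 6" using markov_isosceles that by simp
    then show ?thesis using admissible_presentation_3_6_3 True by blast
  next
    case False
    let ?d = "a' * c' - b"
    have desc: "a'\<^sup>2 + c'\<^sup>2 + ?d\<^sup>2 = a' * c' * ?d" "0 < ?d" "?d < c'" "6 \<le> c'"
      using markov_descent [of a' c' b] False that by simp_all
    have "\<exists>f. admissible_presentation f (a', c', ?d)"
      by (rule less.hyps) (use desc that False in auto)
    then obtain f1 f2 f3 where "admissible_presentation (f1, f2, f3) (a', c', ?d)"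
      by (metis prod_cases3)
    from admissible_presentation_mutation [OF this] show ?thesis by auto
  qed
  show ?case
  proof (cases "a \<le> c")
    case True
    then show ?thesis using ordered less.prems by simp
  next
    case False
    then have "\<exists>f. admissible_presentation f (c, b, a)"
      using less.prems by (intro ordered) (auto simp: algebra_simps)
    then show ?thesis by (metis admissible_presentation_reverse prod_cases3)
  qed
qed

lemma admissible_presentation_reduced:
  assumes "admissible_presentation (f1, f2, f3) t"
  shows "reduced_polynomial_solution (star f1, f2, star f3)"
proof -
  have "\<forall>f\<in>{f1, f2, f3}. s3_free_polynomial f \<and> 0 < deg f"
    using assms unfolding admissible_presentation_def prod.case admissible_iff by auto
  then have "\<forall>f\<in>{f1, f2, f3}. is_polynomial f \<and> nonconstant f \<and> \<not> s3_divides f"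
    using nonconstant_iff_deg_pos s3_free_polynomial_def by blast
  moreover have "star_markov_solution (star f1, f2, star f3)"
    using assms star_markov_solution_orbit unfolding admissible_presentation_def prod.case by blast
  ultimately show ?thesis
    unfolding reduced_polynomial_solution_def by blast
qed

text \<open>
  For k < 0 the terms of f without s3 would get negative exponents, and for k > 0 no term
  without s3 would remain.
\<close>

lemma s3_free_shift:
  assumes "s3_free_polynomial f" "s3_free_polynomial (s3_pow k * f)"
  shows "k = 0"
proof -
  obtain i j where "(i, j, 0) \<in> Poly_Mapping.keys f"
    using assms(1) by (auto simp: s3_free_polynomial_iff)
  then have "(i, j, k) \<in> Poly_Mapping.keys (s3_pow k * f)"
    by (simp add: in_keys_iff lookup_s3_pow_mult)
  then have "0 \<le> k" using assms(2) by (auto simp: s3_free_polynomial_iff)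
  obtain i j where "(i, j, 0) \<in> Poly_Mapping.keys (s3_pow k * f)"
    using assms(2) by (auto simp: s3_free_polynomial_iff)
  then have "(i, j, - k) \<in> Poly_Mapping.keys f"
    by (simp add: in_keys_iff lookup_s3_pow_mult)
  then have "k \<le> 0" using assms(1) by (force simp: s3_free_polynomial_iff)
  with \<open>0 \<le> k\<close> show ?thesis by simp
qed

lemma reduced_polynomial_solution_unique:
  assumes "X \<in> Gamma_M_orbit" "Y \<in> Gamma_M_orbit" "Ev X = (a, b, c)" "Ev Y = (a, b, c)"
    "0 < a" "0 < b" "0 < c" "reduced_polynomial_solution X" "reduced_polynomial_solution Y"
  shows "Y = X"
proof -
  obtain i j where Y: "Y = mu_act i j X"
    using orbit_fibre assms by blast
  obtain f1 f2 f3 g1 g2 g3 where fg: "X = (star f1, f2, star f3)" "Y = (star g1, g2, star g3)"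
    "s3_free_polynomial f1" "s3_free_polynomial f3" "s3_free_polynomial g1" "s3_free_polynomial g3"
    using assms(8,9) unfolding reduced_polynomial_solution_def s3_free_polynomial_def by blast
  have "star g1 = s3_pow i * star f1" "star g3 = s3_pow j * star f3"
    using Y by (auto simp: fg mu_act_def)
  then have "g1 = s3_pow (- i) * f1" "g3 = s3_pow (- j) * f3"
    by (metis star_star star_mult star_s3_pow)+
  then have "- i = 0" "- j = 0"
    using s3_free_shift fg by blast+
  then show ?thesis by (simp add: Y fg mu_act_def)
qed

text \<open>
  Admissibility is known for the solution that was constructed; by uniqueness it holds for every
  reduced solution, since star is injective.
\<close>

lemma admissible_presentation_of_reduced:
  assumes t: "markov_triple (a, b, c)" "a < b" "c < b" "6 \<le> b"
    and X: "(star f1, f2, star f3) \<in> Gamma_M_orbit"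
      "reduced_polynomial_solution (star f1, f2, star f3)" "Ev (star f1, f2, star f3) = (a, b, c)"
  shows "admissible_presentation (f1, f2, f3) (a, b, c)"
proof -
  obtain g1 g2 g3 where g: "admissible_presentation (g1, g2, g3) (a, b, c)"
    using admissible_presentation_exists [OF t] by (metis prod_cases3)
  then have "(star f1, f2, star f3) = (star g1, g2, star g3)"
    using admissible_presentation_reduced [OF g] t X
    by (intro reduced_polynomial_solution_unique [of _ _ a b c])
      (auto simp: admissible_presentation_def)
  then have "f1 = g1" "f2 = g2" "f3 = g3"
    by (metis prod.inject star_star)+
  with g show ?thesis by simp
qed

lemma reduced_polynomial_presentation_iff:
  assumes "markov_triple (a, b, c)" "a < b" "c < b" "6 \<le> b"
  shows "reduced_polynomial_presentation (star f1, f2, star f3) (a, b, c) \<longleftrightarrow>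
    admissible_presentation (f1, f2, f3) (a, b, c)"
proof
  assume "reduced_polynomial_presentation (star f1, f2, star f3) (a, b, c)"
  then show "admissible_presentation (f1, f2, f3) (a, b, c)"
    by (intro admissible_presentation_of_reduced [OF assms])
      (simp_all del: star_markov_solution.simps)
next
  assume pres: "admissible_presentation (f1, f2, f3) (a, b, c)"
  let ?X = "(star f1, f2, star f3)"
  have X: "?X \<in> Gamma_M_orbit" "Ev ?X = (a, b, c)"
    using pres by (simp_all add: admissible_presentation_def)
  have pos: "0 < a" "0 < b" "0 < c" using assms(1) by simp_all
  have "Y = ?X" if "Y \<in> Gamma_M_orbit" "reduced_polynomial_solution Y" "Ev Y = (a, b, c)" for Y
    by (rule reduced_polynomial_solution_unique [OF X(1) that(1) X(2) that(3) pos
          admissible_presentation_reduced [OF pres] that(2)])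
  then show "reduced_polynomial_presentation ?X (a, b, c)"
    unfolding reduced_polynomial_presentation.simps
    using X pos assms admissible_presentation_reduced [OF pres] by blast
qed

lemma markov_mutation:
  assumes "markov_triple (a, b, c)" "a < b" "c < b"
  shows "markov_triple (a, a * b - c, b)" "a < a * b - c" "b < a * b - c"
proof -
  have eq: "a\<^sup>2 + b\<^sup>2 + c\<^sup>2 = a * b * c" and pos: "0 < a" "0 < b" "0 < c"
    using assms(1) by simp_all
  have "3 \<le> a" using markov_entry_ge_3 [OF pos eq] .
  then have "3 * b \<le> a * b" using pos by (simp add: mult_right_mono)
  then show "b < a * b - c" using assms pos by linarith
  then show "a < a * b - c" using assms by linarith
  then show "markov_triple (a, a * b - c, b)"
    using eq pos by (simp add: power2_eq_square algebra_simps)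
qed

lemma presentation_mutation:
  assumes "markov_triple (a, b, c)" "a < b" "c < b" "6 \<le> b"
    "admissible_presentation (f1, f2, f3) (a, b, c)"
  shows "reduced_polynomial_presentation
    (star (mu f1), mu f1 * f2 - s3 ^ deg f1 * f3, star f2) (a, a * b - c, b)"
proof -
  note m = markov_mutation [OF assms(1-3)]
  have "6 \<le> a * b - c" using m assms by linarith
  show ?thesis
    unfolding reduced_polynomial_presentation_iff [OF m \<open>6 \<le> a * b - c\<close>]
    by (rule admissible_presentation_mutation [OF assms(5)])
qed

lemma presentation_reverse:
  assumes t: "markov_triple (c, b, a)" "c < b" "a < b" "6 \<le> b"
    and pres: "reduced_polynomial_presentation (star f3, f2, star f1) (c, b, a)"
  shows "reduced_polynomial_presentation (star f1, f2, star f3) (a, b, c)"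
proof -
  have "markov_triple (a, b, c)" using t(1) by (simp add: algebra_simps)
  then show ?thesis
    using reduced_polynomial_presentation_iff t pres admissible_presentation_reverse by metis
qed

theorem theorem6p4:
  shows
    "(\<forall>a b c :: int.
        markov_triple (a, b, c) \<and> 0 < a \<and> a < b \<and> 0 < c \<and> c < b \<and> 6 \<le> b \<longrightarrow>
          (\<exists>!X. X \<in> Gamma_M_orbit \<and> reduced_polynomial_solution X \<and> Ev X = (a, b, c)) \<and>
          (\<forall>f1 f2 f3.
             (star f1, f2, star f3) \<in> Gamma_M_orbit \<and>
             reduced_polynomial_solution (star f1, f2, star f3) \<and>
             Ev (star f1, f2, star f3) = (a, b, c) \<longrightarrow>
               admissible (f1, f2, f3)))
     \<and>
     (\<forall>(a :: int) (b :: int) (c :: int) f1 f2 f3.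
        markov_triple (a, b, c) \<and> 0 < a \<and> a < b \<and> 0 < c \<and> c < b \<and> 6 \<le> b \<and>
        reduced_polynomial_presentation (star f1, f2, star f3) (a, b, c) \<longrightarrow>
          reduced_polynomial_presentation
            (star (mu f1), mu f1 * f2 - s3 ^ deg f1 * f3, star f2) (a, a * b - c, b) \<and>
          reduced_polynomial_presentation
            (star f2, f2 * mu f3 - s3 ^ deg f3 * f1, star (mu f3)) (b, b * c - a, c))"
proof (intro conjI allI impI)
  fix a b c :: int
  assume "markov_triple (a, b, c) \<and> 0 < a \<and> a < b \<and> 0 < c \<and> c < b \<and> 6 \<le> b"
  then have t: "markov_triple (a, b, c)" "a < b" "c < b" "6 \<le> b"
    and pos: "0 < a" "0 < b" "0 < c"
    by simp_all
  obtain f1 f2 f3 where pres: "admissible_presentation (f1, f2, f3) (a, b, c)"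
    using admissible_presentation_exists [OF t] by (metis prod_cases3)
  let ?X = "(star f1, f2, star f3)"
  have X: "?X \<in> Gamma_M_orbit" "Ev ?X = (a, b, c)"
    using pres by (simp_all add: admissible_presentation_def)
  show "\<exists>!X. X \<in> Gamma_M_orbit \<and> reduced_polynomial_solution X \<and> Ev X = (a, b, c)"
  proof (rule ex1I)
    show "?X \<in> Gamma_M_orbit \<and> reduced_polynomial_solution ?X \<and> Ev ?X = (a, b, c)"
      using X admissible_presentation_reduced [OF pres] by blast
    show "Y = ?X"
      if "Y \<in> Gamma_M_orbit \<and> reduced_polynomial_solution Y \<and> Ev Y = (a, b, c)" for Y
      using reduced_polynomial_solution_unique [OF X(1) _ X(2) _ pos
          admissible_presentation_reduced [OF pres]] that by blast
  qed
  show "admissible (f1, f2, f3)"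
    if "(star f1, f2, star f3) \<in> Gamma_M_orbit \<and>
      reduced_polynomial_solution (star f1, f2, star f3) \<and> Ev (star f1, f2, star f3) = (a, b, c)"
    for f1 f2 f3
    using admissible_presentation_of_reduced [OF t] that
    unfolding admissible_presentation_def by blast
next
  fix a b c :: int and f1 f2 f3
  assume "markov_triple (a, b, c) \<and> 0 < a \<and> a < b \<and> 0 < c \<and> c < b \<and> 6 \<le> b \<and>
    reduced_polynomial_presentation (star f1, f2, star f3) (a, b, c)"
  then have t: "markov_triple (a, b, c)" "a < b" "c < b" "6 \<le> b"
    and "reduced_polynomial_presentation (star f1, f2, star f3) (a, b, c)"
    by blast+
  then have pres: "admissible_presentation (f1, f2, f3) (a, b, c)"
    using reduced_polynomial_presentation_iff [OF t] by blast
  then show "reduced_polynomial_presentation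
      (star (mu f1), mu f1 * f2 - s3 ^ deg f1 * f3, star f2) (a, a * b - c, b)"
    using t by (rule presentation_mutation [rotated -1])
  have t': "markov_triple (c, b, a)" using t(1) by (simp add: algebra_simps)
  have "reduced_polynomial_presentation
      (star (mu f3), mu f3 * f2 - s3 ^ deg f3 * f1, star f2) (c, c * b - a, b)"
    by (rule presentation_mutation [OF t' t(3,2,4) admissible_presentation_reverse [OF pres]])
  moreover have "6 \<le> c * b - a"
    using markov_mutation(3) [OF t' t(3,2)] t(4) by linarith
  ultimately have "reduced_polynomial_presentation
      (star f2, mu f3 * f2 - s3 ^ deg f3 * f1, star (mu f3)) (b, c * b - a, c)"
    using markov_mutation [OF t' t(3,2)] by (metis presentation_reverse)
  then show "reduced_polynomial_presentation
      (star f2, f2 * mu f3 - s3 ^ deg f3 * f1, star (mu f3)) (b, b * c - a, c)"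
    by (simp only: mult.commute)
qed

end
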